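(* Let $t_0\ge1$, $\gamma(t)=\frac{\alpha}{t^r}$ with $r\in(-1,0]$ and $\alpha>0$, and $\delta(t)=\frac{t}{2r_0}$ with $r_0>\frac{r+1}{2}$. Let $\epsilon_1:[t_0,+\infty)\to\mathbb{R}^{n_1}$ and $\epsilon_2:[t_0,+\infty)\to\mathbb{R}^{n_2}$ be locally integrable functions satisfying $$\int_{t_0}^{+\infty}t^{\frac{r+1}{2}}\|\epsilon_i(t)\|\,dt<+\infty,\qquad i=1,2.$$ Suppose that $(x^*,y^*,\lambda^* )\in\Omega$ and that $(x(t),y(t),\lambda(t))$ is a global solution of the perturbed dynamical system (P) (given in the context). Then: (a) $\mathcal{L}(x(t),y(t),\lambda^* )-\mathcal{L}(x^*,y^*,\lambda^* )=\mathcal{O}(t^{-(r+1)})$. (b) $\|Ax(t)+By(t)-b\|=\mathcal{O}(t^{-\frac{r+1}{2}})$. (c) $\int_{t_0}^{+\infty}t^r\|Ax(t)+By(t)-b\|^2\,dt<+\infty$. (d) $\int_{t_0}^{+\infty}t\big(\|\dot x(t)\|^2+\|\dot y(t)\|^2+\|\dot\lambda(t)\|^2\big)\,dt<+\infty$. (e) $\int_{t_0}^{+\infty}t^r\big(\mathcal{L}(x(t),y(t),\lambda^* )-\mathcal{L}(x^*,y^*,\lambda^* )\big)\,dt<+\infty$. (f) $\|\dot x(t)\|+\|\dot y(t)\|+\|\dot\lambda(t)\|=\mathcal{O}(t^{-\frac{r+1}{2}})$.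
   Context: All spaces are Euclidean with inner product $\langle\cdot,\cdot\rangle$ and norm $\|\cdot\|$. $f:\mathbb{R}^{n_1}\to\mathbb{R}$ and $g:\mathbb{R}^{n_2}\to\mathbb{R}$ are smooth (continuously differentiable) convex functions, $A\in\mathbb{R}^{m\times n_1}$, $B\in\mathbb{R}^{m\times n_2}$, $b\in\mathbb{R}^m$. $\Omega$ is the set of $(x^*,y^*,\lambda^* )\in\mathbb{R}^{n_1}\times\mathbb{R}^{n_2}\times\mathbb{R}^m$ with $-A^T\lambda^*=\nabla f(x^* )$, $-B^T\lambda^*=\nabla g(y^* )$, $Ax^*+By^*-b=0$; it is assumed that $\Omega\neq\emptyset$. The augmented Lagrangian is $$\mathcal{L}(x,y,\lambda)=f(x)+g(y)+\langle\lambda,Ax+By-b\rangle+\tfrac12\|Ax+By-b\|^2.$$ The perturbed dynamical system (P) is $$\begin{cases}\ddot{x}(t)+\gamma(t)\dot{x}(t)=-\nabla f(x(t))-A^T(\lambda(t)+\delta(t)\dot\lambda(t))-A^T(Ax(t)+By(t)-b)+\epsilon_1(t),\\ \ddot{y}(t)+\gamma(t)\dot{y}(t)=-\nabla g(y(t))-B^T(\lambda(t)+\delta(t)\dot\lambda(t))-B^T(Ax(t)+By(t)-b)+\epsilon_2(t),\\ \ddot{\lambda}(t)+\gamma(t)\dot{\lambda}(t)=A(x(t)+\delta(t)\dot{x}(t))+B(y(t)+\delta(t)\dot{y}(t))-b.\end{cases}$$ A global solution is a triple of $C^1$ functions on $[t_0,+\infty)$ with locally absolutely continuous first derivatives satisfying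 (P) for almost every $t\ge t_0$. All $\mathcal{O}(\cdot)$ statements are as $t\to+\infty$. *)

theory Defs
  imports "HOL-Analysis.Analysis" "HOL-Library.Landau_Symbols"
begin

definition smooth_convex :: "('a::euclidean_space \<Rightarrow> real) \<Rightarrow> ('a \<Rightarrow> 'a) \<Rightarrow> bool" where
  "smooth_convex f gradf \<longleftrightarrow>
     convex_on UNIV f \<and> (\<forall>x. GDERIV f x :> gradf x) \<and> continuous_on UNIV gradf"

definition kkt_set ::
  "(real^'n1 \<Rightarrow> real^'n1) \<Rightarrow> (real^'n2 \<Rightarrow> real^'n2) \<Rightarrow> real^'n1^'m \<Rightarrow> real^'n2^'m \<Rightarrow> real^'m \<Rightarrow>
   ((real^'n1) \<times> (real^'n2) \<times> (real^'m)) set" where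
  "kkt_set gradf gradg A B b =
     {(x, y, l). - (transpose A *v l) = gradf x \<and> - (transpose B *v l) = gradg y \<and>
                 A *v x + B *v y - b = 0}"

definition aug_lagrangian ::
  "(real^'n1 \<Rightarrow> real) \<Rightarrow> (real^'n2 \<Rightarrow> real) \<Rightarrow> real^'n1^'m \<Rightarrow> real^'n2^'m \<Rightarrow> real^'m \<Rightarrow>
   real^'n1 \<Rightarrow> real^'n2 \<Rightarrow> real^'m \<Rightarrow> real" where
  "aug_lagrangian f g A B b x y l =
     f x + g y + l \<bullet> (A *v x + B *v y - b) + 1/2 * (norm (A *v x + B *v y - b))\<^sup>2"

text \<open>
  The usual epsilon-delta definition: \<open>D\<close> ranges over the finite families of non-overlapping
  compact subintervals of \<open>[a, b]\<close>, and \<open>Inf K\<close>, \<open>Sup K\<close> are the end points of \<open>K\<close>.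
\<close>
definition abs_continuous_on_interval ::
  "real \<Rightarrow> real \<Rightarrow> (real \<Rightarrow> 'a::real_normed_vector) \<Rightarrow> bool" where
  "abs_continuous_on_interval a b u \<longleftrightarrow>
     (\<forall>e>0. \<exists>d>0. \<forall>D S. D division_of S \<longrightarrow> S \<subseteq> {a..b} \<longrightarrow>
        (\<Sum>K\<in>D. Sup K - Inf K) < d \<longrightarrow> (\<Sum>K\<in>D. norm (u (Sup K) - u (Inf K))) < e)"

text \<open>
  \<open>u'\<close> is the derivative of \<open>u\<close> on \<open>[t0, \<infinity>)\<close>, one-sided at \<open>t0\<close>; values of \<open>u\<close> and \<open>u'\<close>
  to the left of \<open>t0\<close> play no role.
\<close>
definition C1_with_locally_ac_deriv ::
  "real \<Rightarrow> (real \<Rightarrow> 'a::real_normed_vector) \<Rightarrow> (real \<Rightarrow> 'a) \<Rightarrow> bool" where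
  "C1_with_locally_ac_deriv t0 u u' \<longleftrightarrow>
     (\<forall>t\<ge>t0. (u has_vector_derivative u' t) (at t within {t0..})) \<and>
     continuous_on {t0..} u' \<and>
     (\<forall>a b. t0 \<le> a \<longrightarrow> a \<le> b \<longrightarrow> abs_continuous_on_interval a b u')"

definition global_solution ::
  "(real^'n1 \<Rightarrow> real^'n1) \<Rightarrow> (real^'n2 \<Rightarrow> real^'n2) \<Rightarrow> real^'n1^'m \<Rightarrow> real^'n2^'m \<Rightarrow> real^'m \<Rightarrow>
   real \<Rightarrow> (real \<Rightarrow> real) \<Rightarrow> (real \<Rightarrow> real) \<Rightarrow> (real \<Rightarrow> real^'n1) \<Rightarrow> (real \<Rightarrow> real^'n2) \<Rightarrow>
   (real \<Rightarrow> real^'n1) \<Rightarrow> (real \<Rightarrow> real^'n2) \<Rightarrow> (real \<Rightarrow> real^'m) \<Rightarrow>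
   (real \<Rightarrow> real^'n1) \<Rightarrow> (real \<Rightarrow> real^'n2) \<Rightarrow> (real \<Rightarrow> real^'m) \<Rightarrow> bool" where
  "global_solution gradf gradg A B b t0 \<gamma> \<delta> \<epsilon>1 \<epsilon>2 x y l x' y' l' \<longleftrightarrow>
     C1_with_locally_ac_deriv t0 x x' \<and>
     C1_with_locally_ac_deriv t0 y y' \<and>
     C1_with_locally_ac_deriv t0 l l' \<and>
     (AE t in lebesgue. t \<ge> t0 \<longrightarrow> (\<exists>x'' y'' l''.
        (x' has_vector_derivative x'') (at t within {t0..}) \<and>
        (y' has_vector_derivative y'') (at t within {t0..}) \<and>
        (l' has_vector_derivative l'') (at t within {t0..}) \<and>
        x'' + \<gamma> t *\<^sub>R x' t =
          - gradf (x t) - transpose A *v (l t + \<delta> t *\<^sub>R l' t)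
          - transpose A *v (A *v x t + B *v y t - b) + \<epsilon>1 t \<and>
        y'' + \<gamma> t *\<^sub>R y' t =
          - gradg (y t) - transpose B *v (l t + \<delta> t *\<^sub>R l' t)
          - transpose B *v (A *v x t + B *v y t - b) + \<epsilon>2 t \<and>
        l'' + \<gamma> t *\<^sub>R l' t =
          A *v (x t + \<delta> t *\<^sub>R x' t) + B *v (y t + \<delta> t *\<^sub>R y' t) - b))"

definition locally_integrable_from :: "real \<Rightarrow> (real \<Rightarrow> 'a::euclidean_space) \<Rightarrow> bool" where
  "locally_integrable_from t0 u \<longleftrightarrow>
     (\<forall>a b. t0 \<le> a \<longrightarrow> a \<le> b \<longrightarrow> u absolutely_integrable_on {a..b})"

end

theory Submission
  imports Defs
begin

text \<open>
  Write \<open>w = (x, y, l)\<close>, \<open>w\<^sub>* = (xs, ys, ls)\<close>, \<open>\<delta> t = t / (2 r0)\<close>, \<open>v = w - w\<^sub>* + \<delta> w'\<close>, let \<open>L\<close> be the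
  gap of the augmented Lagrangian (at the multiplier \<open>ls\<close>) along the trajectory and \<open>\<rho>\<close> the
  feasibility residual. Everything follows from the energy
  \<open>E = t\<^sup>r\<^sup>+\<^sup>1 L + 2 r0\<^sup>2 t\<^sup>r\<^sup>-\<^sup>1 |v|\<^sup>2 + r0 \<alpha> |w - w\<^sub>*|\<^sup>2\<close>.

  Tested with \<open>v\<close>, the coupling between primal and dual variables cancels, and convexity leaves
  \<open>- \<delta> L' - L - |\<rho>|\<^sup>2 / 2\<close> plus the perturbation (\<open>primal_dual_dissipation\<close>). Because the
  coefficient of \<open>|v|\<^sup>2 / 2\<close> in \<open>E\<close>, multiplied by \<open>\<delta>\<^sup>2\<close>, is that of \<open>L\<close>, the terms with \<open>L'\<close> cancel in
  \<open>E'\<close>; the same coefficient multiplied by \<open>\<delta> \<alpha> t\<^sup>-\<^sup>r\<close> is the constant \<open>2 r0 \<alpha>\<close>, so the damping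
  cancels the derivative of \<open>r0 \<alpha> |w - w\<^sub>*|\<^sup>2\<close> and leaves \<open>- \<alpha> t |w'|\<^sup>2\<close>. The growth of \<open>t\<^sup>r\<^sup>+\<^sup>1\<close> is
  beaten by the term \<open>- 2 r0 t\<^sup>r L\<close>, which is where \<open>r0 > (r + 1) / 2\<close> enters. All other terms are
  absorbed for large \<open>t\<close>, and what results (\<open>lyapunov_derivative_le\<close>) is
  \<open>E' \<le> k (1 + E) - D\<close> almost everywhere, where \<open>k\<close> is integrable and the dissipation \<open>D\<close> consists of
  positive multiples of \<open>t\<^sup>r L\<close>, \<open>t\<^sup>r |\<rho>|\<^sup>2\<close> and \<open>t |w'|\<^sup>2\<close>. A Gronwall argument
  (\<open>absolutely_continuous_gronwall\<close>) shows that \<open>E\<close> and the integral of \<open>D\<close> are bounded. The latter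
  gives the three integrability claims; the former gives the decay of \<open>L\<close>, hence of the residual,
  since \<open>L \<ge> |\<rho>|\<^sup>2 / 2\<close>, and of \<open>w'\<close>, since \<open>\<delta> w' = v - (w - w\<^sub>*)\<close>.

  The velocity is only absolutely continuous, so integrating \<open>E'\<close> requires the fundamental theorem
  of calculus for absolutely continuous functions that are differentiable almost everywhere
  (\<open>fundamental_theorem_of_calculus_absolutely_continuous\<close>).
\<close>

section \<open>The fundamental theorem of calculus for absolutely continuous functions\<close>

text \<open>
  Divisions in the definition of absolute continuity are sets of intervals, whereas the gauge
  integral works with tagged intervals. Passing from one to the other is harmless: distinct tagged
  intervals do not overlap, so they could coincide as sets only if they were degenerate, and a
  degenerate interval contributes nothing to either sum.
\<close>

lemma sum_absolutely_continuous_less: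
  fixes u :: "real \<Rightarrow> 'a::real_normed_vector"
  assumes ac: "abs_continuous_on_interval a b u" and "e > 0"
  obtains d where "d > 0"
    "\<And>q S. q tagged_partial_division_of S \<Longrightarrow> S \<subseteq> {a..b} \<Longrightarrow>
       (\<Sum>(x, K)\<in>q. measure lborel K) < d \<Longrightarrow> (\<Sum>(x, K)\<in>q. norm (u (Sup K) - u (Inf K))) < e"
proof -
  obtain d where d: "d > 0"
    "\<And>D S. D division_of S \<Longrightarrow> S \<subseteq> {a..b} \<Longrightarrow> (\<Sum>K\<in>D. Sup K - Inf K) < d \<Longrightarrow>
        (\<Sum>K\<in>D. norm (u (Sup K) - u (Inf K))) < e"
    using ac \<open>e > 0\<close> unfolding abs_continuous_on_interval_def by meson
  show thesis
  proof (rule that[OF d(1)])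
    fix q S
    assume q: "q tagged_partial_division_of S" and S: "S \<subseteq> {a..b}"
      and small: "(\<Sum>(x, K)\<in>q. measure lborel K) < d"
    define U where "U = \<Union>(snd ` q)"
    have qU: "q tagged_division_of U"
      unfolding U_def by (rule tagged_partial_division_of_Union_self[OF q])
    have US: "U \<subseteq> {a..b}"
      using tagged_partial_division_ofD(3)[OF q] S unfolding U_def by fastforce
    have div: "(snd ` q) division_of U"
      by (rule division_of_tagged_division[OF qU])
    have nondeg: "u' = v'" if "box u' v' = {}" "cbox u' v' \<in> snd ` q" for u' v' :: real
    proof -
      have "cbox u' v' \<noteq> {}" using that(2) div by blast
      then show ?thesis using that(1) by (auto simp: box_real)
    qed
    have len: "measure lborel K = Sup K - Inf K" if K: "K \<in> snd ` q" for K
    proof -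
      obtain s t where "K = {s..t}" using division_ofD(4)[OF div K] by auto
      moreover have "K \<noteq> {}" using division_ofD(3)[OF div K] .
      ultimately show ?thesis by simp
    qed
    define h where "h g K = (if K \<in> snd ` q then g K else 0)" for g :: "real set \<Rightarrow> real" and K
    have tagless: "(\<Sum>(x, K)\<in>q. g K) = (\<Sum>K\<in>snd ` q. g K)"
      if "\<And>s. g {s..s} = 0" for g :: "real set \<Rightarrow> real"
    proof -
      have "(\<Sum>(x, K)\<in>q. g K) = (\<Sum>(x, K)\<in>q. h g K)"
        by (rule sum.cong) (auto simp: h_def image_iff split: prod.splits)
      also have "\<dots> = (\<Sum>K\<in>snd ` q. h g K)"
      proof (rule sum.over_tagged_division_lemma[OF qU])
        fix s t :: real assume box: "box s t = {}"
        show "h g (cbox s t) = 0"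
        proof (cases "cbox s t \<in> snd ` q")
          case True
          have "s = t" by (rule nondeg[OF box True])
          then show ?thesis using that[of t] by (simp only: h_def box_real if_cancel)
        next
          case False
          then show ?thesis by (simp only: h_def if_False)
        qed
      qed
      finally show ?thesis by (simp add: h_def)
    qed
    have "(\<Sum>K\<in>snd ` q. Sup K - Inf K) = (\<Sum>K\<in>snd ` q. measure lborel K)"
      by (rule sum.cong) (simp_all add: len)
    also have "\<dots> = (\<Sum>(x, K)\<in>q. measure lborel K)"
      using tagless[of "measure lborel"] by simp
    finally have "(\<Sum>K\<in>snd ` q. Sup K - Inf K) < d"
      using small by simp
    then have "(\<Sum>K\<in>snd ` q. norm (u (Sup K) - u (Inf K))) < e"
      by (rule d(2)[OF div US])
    then show "(\<Sum>(x, K)\<in>q. norm (u (Sup K) - u (Inf K))) < e"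
      using tagless[of "\<lambda>K. norm (u (Sup K) - u (Inf K))"] by simp
  qed
qed

lemma straddle_estimate:
  fixes u :: "real \<Rightarrow> 'a::real_normed_vector"
  assumes "(u has_vector_derivative D) (at x within S)" and "e > 0"
  obtains d where "d > 0"
    "\<And>s t. s \<in> S \<Longrightarrow> t \<in> S \<Longrightarrow> s \<le> x \<Longrightarrow> x \<le> t \<Longrightarrow> \<bar>s - x\<bar> < d \<Longrightarrow> \<bar>t - x\<bar> < d \<Longrightarrow>
       norm ((t - s) *\<^sub>R D - (u t - u s)) \<le> e * (t - s)"
proof -
  obtain d where d: "d > 0"
    "\<And>y. y \<in> S \<Longrightarrow> norm (y - x) < d \<Longrightarrow> norm (u y - u x - (y - x) *\<^sub>R D) \<le> e * norm (y - x)"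
    using assms unfolding has_vector_derivative_def has_derivative_within_alt by blast
  show thesis
  proof (rule that[OF d(1)])
    fix s t assume st: "s \<in> S" "t \<in> S" "s \<le> x" "x \<le> t" "\<bar>s - x\<bar> < d" "\<bar>t - x\<bar> < d"
    have "norm ((t - s) *\<^sub>R D - (u t - u s))
        = norm ((u s - u x - (s - x) *\<^sub>R D) - (u t - u x - (t - x) *\<^sub>R D))"
      by (simp add: algebra_simps)
    also have "\<dots> \<le> norm (u s - u x - (s - x) *\<^sub>R D) + norm (u t - u x - (t - x) *\<^sub>R D)"
      by (rule norm_triangle_ineq4)
    also have "\<dots> \<le> e * norm (s - x) + e * norm (t - x)"
      using d(2)[of s] d(2)[of t] st by simp
    also have "\<dots> = e * (t - s)"
      using st by (simp add: algebra_simps)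
    finally show "norm ((t - s) *\<^sub>R D - (u t - u s)) \<le> e * (t - s)" .
  qed
qed

lemma negligible_outer_open:
  fixes N :: "real set"
  assumes "negligible N" and "d > 0"
  obtains U where "open U" "N \<subseteq> U" "U \<in> lmeasurable" "measure lebesgue U < d"
proof -
  obtain U where U: "open U" "N \<subseteq> U" "U - N \<in> lmeasurable" "emeasure lebesgue (U - N) < ennreal d"
    using sets_lebesgue_outer_open[OF negligible_imp_sets[OF assms(1)] assms(2)] by blast
  have N: "N \<in> lmeasurable" "measure lebesgue N = 0"
    using assms(1) by (simp_all add: negligible_imp_measurable negligible_imp_measure0)
  have "U = (U - N) \<union> N" using U(2) by auto
  then have mU: "U \<in> lmeasurable" using U(3) N(1) by (metis fmeasurable.Un)
  have "measure lebesgue U = measure lebesgue (U - N)"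
    using assms(1) mU by (simp add: measure_Diff_null_set negligible_iff_null_sets fmeasurableD)
  also have "\<dots> < d"
    using U(3,4) assms(2) by (simp add: emeasure_eq_measure2 ennreal_less_iff)
  finally show thesis using that U mU by blast
qed

lemma sum_content_le_measure:
  fixes q :: "(real \<times> real set) set"
  assumes q: "q tagged_partial_division_of S" and U: "U \<in> lmeasurable"
    and sub: "\<And>x K. (x, K) \<in> q \<Longrightarrow> K \<subseteq> U"
  shows "(\<Sum>(x, K)\<in>q. measure lborel K) \<le> measure lebesgue U"
proof -
  define V where "V = \<Union>(snd ` q)"
  have qV: "q tagged_division_of V"
    unfolding V_def by (rule tagged_partial_division_of_Union_self[OF q])
  have div: "(snd ` q) division_of V" by (rule division_of_tagged_division[OF qV])
  have "(\<Sum>(x, K)\<in>q. measure lborel K) = (\<Sum>K\<in>snd ` q. measure lborel K)"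
    by (rule sum.over_tagged_division_lemma[OF qV]) (simp add: content_eq_0_interior)
  also have "\<dots> = (\<Sum>K\<in>snd ` q. measure lebesgue K)"
  proof (rule sum.cong[OF refl])
    fix K assume "K \<in> snd ` q"
    then obtain s t where "K = cbox s t" using division_ofD(4)[OF div] by blast
    then show "measure lborel K = measure lebesgue K" by simp
  qed
  also have "\<dots> = measure lebesgue V"
    by (rule content_division[OF div])
  also have "\<dots> \<le> measure lebesgue U"
  proof (rule measure_mono_fmeasurable)
    show "V \<subseteq> U" using sub unfolding V_def by fastforce
    show "V \<in> sets lebesgue" using lmeasurable_division[OF div] by (rule fmeasurableD)
  qed (rule U)
  finally show ?thesis .
qed

text \<open>
  The gauge integral gives this directly, without Vitali coverings or Lebesgue differentiation.
  Outside \<open>N\<close> the gauge is chosen by the straddle estimate, so that the Riemann sum telescopes up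
  to a multiple of the length of the interval. At a tag in \<open>N\<close> the integrand is set to \<open>0\<close> and the
  gauge confines the interval to an open set \<open>U \<supseteq> N\<close> of tiny measure, so that absolute continuity
  makes the total increment over all these intervals small.
\<close>

theorem fundamental_theorem_of_calculus_absolutely_continuous:
  fixes u :: "real \<Rightarrow> 'a::euclidean_space"
  assumes "a \<le> b" and ac: "abs_continuous_on_interval a b u" and N: "negligible N"
    and deriv: "\<And>t. t \<in> {a..b} - N \<Longrightarrow> (u has_vector_derivative u' t) (at t within {a..b})"
  shows "(u' has_integral (u b - u a)) {a..b}"
proof -
  define v where "v t = (if t \<in> N then 0 else u' t)" for t
  have "(v has_integral (u b - u a)) {a..b}"
    unfolding has_integral_real
  proof (intro allI impI)
    fix e :: real assume "e > 0"
    \<comment> \<open>The summand \<open>1\<close> covers the case \<open>a = b\<close>.\<close>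
    define c where "c = e / (2 * (b - a + 1))"
    have "c > 0" using \<open>e > 0\<close> \<open>a \<le> b\<close> by (simp add: c_def)
    have c_less: "c * (b - a) < e / 2"
      using \<open>e > 0\<close> \<open>a \<le> b\<close> by (simp add: c_def field_simps)
    obtain d where d: "d > 0"
      "\<And>q S. q tagged_partial_division_of S \<Longrightarrow> S \<subseteq> {a..b} \<Longrightarrow>
         (\<Sum>(x, K)\<in>q. measure lborel K) < d \<Longrightarrow> (\<Sum>(x, K)\<in>q. norm (u (Sup K) - u (Inf K))) < e / 2"
      using sum_absolutely_continuous_less[OF ac, of "e / 2"] \<open>e > 0\<close> by auto
    obtain U where U: "open U" "N \<subseteq> U" "U \<in> lmeasurable" "measure lebesgue U < d"
      using negligible_outer_open[OF N d(1)] .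
    have "\<exists>\<rho>>0. (x \<in> N \<longrightarrow> ball x \<rho> \<subseteq> U) \<and>
        (x \<in> {a..b} - N \<longrightarrow> (\<forall>s\<in>{a..b}. \<forall>t\<in>{a..b}. s \<le> x \<longrightarrow> x \<le> t \<longrightarrow> \<bar>s - x\<bar> < \<rho> \<longrightarrow>
           \<bar>t - x\<bar> < \<rho> \<longrightarrow> norm ((t - s) *\<^sub>R u' x - (u t - u s)) \<le> c * (t - s)))" for x
    proof (cases "x \<in> N")
      case True
      then show ?thesis using openE[OF U(1), of x] U(2) by blast
    next
      case False
      then show ?thesis
      proof (cases "x \<in> {a..b}")
        case True
        then have "(u has_vector_derivative u' x) (at x within {a..b})"
          using deriv[of x] False by blast
        from straddle_estimate[OF this \<open>c > 0\<close>] obtain \<rho> where "\<rho> > 0"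
          "\<And>s t. \<lbrakk>s \<in> {a..b}; t \<in> {a..b}; s \<le> x; x \<le> t; \<bar>s - x\<bar> < \<rho>; \<bar>t - x\<bar> < \<rho>\<rbrakk>
             \<Longrightarrow> norm ((t - s) *\<^sub>R u' x - (u t - u s)) \<le> c * (t - s)"
          by metis
        then show ?thesis
          using False by (intro exI[of _ \<rho>]) simp
      qed (auto intro: exI[of _ 1])
    qed
    then obtain \<rho> where \<rho>: "\<And>x. \<rho> x > 0" "\<And>x. x \<in> N \<Longrightarrow> ball x (\<rho> x) \<subseteq> U"
      "\<And>x s t. \<lbrakk>x \<in> {a..b} - N; s \<in> {a..b}; t \<in> {a..b}; s \<le> x; x \<le> t; \<bar>s - x\<bar> < \<rho> x; \<bar>t - x\<bar> < \<rho> x\<rbrakk>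
         \<Longrightarrow> norm ((t - s) *\<^sub>R u' x - (u t - u s)) \<le> c * (t - s)"
      by metis
    show "\<exists>\<gamma>. gauge \<gamma> \<and> (\<forall>\<D>. \<D> tagged_division_of {a..b} \<and> \<gamma> fine \<D> \<longrightarrow>
        norm ((\<Sum>(x, k)\<in>\<D>. measure lborel k *\<^sub>R v x) - (u b - u a)) < e)"
    proof (intro exI[of _ "\<lambda>x. ball x (\<rho> x)"] conjI allI impI)
      show "gauge (\<lambda>x. ball x (\<rho> x))" by (simp add: gauge_ball_dependent \<rho>(1))
    next
      fix p assume "p tagged_division_of {a..b} \<and> (\<lambda>x. ball x (\<rho> x)) fine p"
      then have p: "p tagged_division_of {a..b}" and fine: "\<And>x K. (x, K) \<in> p \<Longrightarrow> K \<subseteq> ball x (\<rho> x)"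
        by (auto simp: fine_def)
      have finp: "finite p" using p by blast
      define \<Phi> where "\<Phi> = (\<lambda>(x, K). measure lborel K *\<^sub>R v x - (u (Sup K) - u (Inf K)))"
      define q where "q = {z \<in> p. fst z \<in> N}"
      have qp: "q \<subseteq> p" by (auto simp: q_def)
      have q: "q tagged_partial_division_of {a..b}"
        using tagged_partial_division_subset[OF _ qp] p unfolding tagged_division_of_def by auto
      have shape: "x \<in> {a..b} \<and> measure lborel K = Sup K - Inf K \<and> Inf K \<in> K \<and> Sup K \<in> K \<and> K \<subseteq> {a..b}
          \<and> Inf K \<le> x \<and> x \<le> Sup K" if xK: "(x, K) \<in> p" for x K
      proof -
        have "x \<in> K" "K \<subseteq> {a..b}" using tagged_division_ofD(2,3)[OF p xK] by auto
        moreover obtain s t where "K = {s..t}" using tagged_division_ofD(4)[OF p xK] by auto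
        ultimately show ?thesis by auto
      qed
      \<comment> \<open>Tags in \<open>N\<close>: \<open>v\<close> vanishes there, and only the increments of \<open>u\<close> remain.\<close>
      have "norm (\<Sum>z\<in>q. \<Phi> z) \<le> (\<Sum>(x, K)\<in>q. norm (u (Sup K) - u (Inf K)))"
        by (rule sum_norm_le) (auto simp: q_def \<Phi>_def v_def norm_minus_commute)
      also have "\<dots> < e / 2"
      proof (rule d(2)[OF q])
        have "(\<Sum>(x, K)\<in>q. measure lborel K) \<le> measure lebesgue U"
          by (rule sum_content_le_measure[OF q U(3)]) (use fine \<rho>(2) q_def in fastforce)
        then show "(\<Sum>(x, K)\<in>q. measure lborel K) < d" using U(4) by simp
      qed simp
      finally have bad: "norm (\<Sum>z\<in>q. \<Phi> z) < e / 2" .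
      \<comment> \<open>Tags outside \<open>N\<close>: the errors add up to at most \<open>c (b - a)\<close>.\<close>
      have "norm (\<Sum>z\<in>p - q. \<Phi> z) \<le> (\<Sum>(x, K)\<in>p - q. c * measure lborel K)"
      proof (rule sum_norm_le)
        fix z assume z: "z \<in> p - q"
        obtain x K where zeq: "z = (x, K)" by fastforce
        have xK: "(x, K) \<in> p" "x \<notin> N" using z zeq by (auto simp: q_def)
        note sh = shape[OF xK(1)]
        have "Inf K \<in> ball x (\<rho> x)" "Sup K \<in> ball x (\<rho> x)" using fine[OF xK(1)] sh by auto
        then have "norm ((Sup K - Inf K) *\<^sub>R u' x - (u (Sup K) - u (Inf K))) \<le> c * (Sup K - Inf K)"
          using sh xK(2) by (intro \<rho>(3)) (auto simp: dist_real_def)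
        then show "norm (\<Phi> z) \<le> (case z of (x, K) \<Rightarrow> c * measure lborel K)"
          using sh xK(2) by (simp add: zeq \<Phi>_def v_def)
      qed
      also have "\<dots> \<le> (\<Sum>(x, K)\<in>p. c * measure lborel K)"
        using finp \<open>c > 0\<close> by (intro sum_mono2) (auto simp: mult_nonneg_nonneg)
      also have "\<dots> = c * (b - a)"
        using additive_content_tagged_division[of p a b] p \<open>a \<le> b\<close>
        by (simp add: sum_distrib_left[symmetric] split_def)
      finally have good: "norm (\<Sum>z\<in>p - q. \<Phi> z) < e / 2" using c_less by simp
      have "(\<Sum>(x, k)\<in>p. measure lborel k *\<^sub>R v x) - (u b - u a) = (\<Sum>z\<in>p. \<Phi> z)"
        using additive_tagged_division_1[OF \<open>a \<le> b\<close> p, of u]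
        by (simp add: \<Phi>_def split_def sum_subtractf)
      also have "\<dots> = (\<Sum>z\<in>p - q. \<Phi> z) + (\<Sum>z\<in>q. \<Phi> z)"
        using sum.subset_diff[OF qp finp] .
      finally show "norm ((\<Sum>(x, k)\<in>p. measure lborel k *\<^sub>R v x) - (u b - u a)) < e"
        using bad good norm_triangle_ineq[of "\<Sum>z\<in>p - q. \<Phi> z" "\<Sum>z\<in>q. \<Phi> z"] by simp
    qed
  qed
  then show ?thesis
    by (rule has_integral_spike[OF N, rotated]) (simp add: v_def)
qed

section \<open>Operations on absolutely continuous functions\<close>

lemma abs_continuous_imp_continuous_on:
  assumes "abs_continuous_on_interval a b u"
  shows "continuous_on {a..b} u"
  unfolding continuous_on_iff
proof (intro ballI allI impI)
  fix x e :: real assume x: "x \<in> {a..b}" and "e > 0"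
  obtain d where d: "d > 0"
    "\<And>D S. D division_of S \<Longrightarrow> S \<subseteq> {a..b} \<Longrightarrow> (\<Sum>K\<in>D. Sup K - Inf K) < d \<Longrightarrow>
        (\<Sum>K\<in>D. norm (u (Sup K) - u (Inf K))) < e"
    using assms \<open>e > 0\<close> unfolding abs_continuous_on_interval_def by meson
  have step: "norm (u t - u s) < e" if st: "s \<in> {a..b}" "t \<in> {a..b}" "s \<le> t" "t - s < d" for s t
  proof -
    have "{{s..t}} division_of {s..t}"
      using st(3) division_of_self[of s t] by simp
    from d(2)[OF this] show ?thesis using st by simp
  qed
  show "\<exists>d>0. \<forall>y\<in>{a..b}. dist y x < d \<longrightarrow> dist (u y) (u x) < e"
  proof (intro exI[of _ d] conjI ballI impI d(1))
    fix y assume y: "y \<in> {a..b}" "dist y x < d"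
    show "dist (u y) (u x) < e"
    proof (cases "x \<le> y")
      case True
      then show ?thesis using step[of x y] x y by (simp add: dist_norm)
    next
      case False
      then show ?thesis using step[of y x] x y by (simp add: dist_norm norm_minus_commute)
    qed
  qed
qed

lemma abs_continuous_bounded:
  assumes "abs_continuous_on_interval a b u"
  obtains B where "B > 0" "\<And>t. t \<in> {a..b} \<Longrightarrow> norm (u t) \<le> B"
proof -
  have "bounded (u ` {a..b})"
    by (intro compact_imp_bounded compact_continuous_image abs_continuous_imp_continuous_on assms) simp
  then show thesis using that by (auto simp: bounded_pos)
qed

text \<open>
  The one closure property from which the others follow: sums, bilinear products, pairs and
  \<open>C\<^sup>1\<close> functions all have increments dominated by those of absolutely continuous functions.
\<close>

lemma abs_continuous_controlled:
  assumes u: "abs_continuous_on_interval a b u" and v: "abs_continuous_on_interval a b v"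
    and "C > 0"
    and le: "\<And>s t. s \<in> {a..b} \<Longrightarrow> t \<in> {a..b} \<Longrightarrow>
      norm (w t - w s) \<le> C * (norm (u t - u s) + norm (v t - v s))"
  shows "abs_continuous_on_interval a b w"
  unfolding abs_continuous_on_interval_def
proof (intro allI impI)
  fix e :: real assume "e > 0"
  then have "e / (2 * C) > 0" using \<open>C > 0\<close> by simp
  obtain d1 where d1: "d1 > 0"
    "\<And>D S. D division_of S \<Longrightarrow> S \<subseteq> {a..b} \<Longrightarrow> (\<Sum>K\<in>D. Sup K - Inf K) < d1 \<Longrightarrow>
        (\<Sum>K\<in>D. norm (u (Sup K) - u (Inf K))) < e / (2 * C)"
    using u \<open>e / (2 * C) > 0\<close> unfolding abs_continuous_on_interval_def by meson
  obtain d2 where d2: "d2 > 0"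
    "\<And>D S. D division_of S \<Longrightarrow> S \<subseteq> {a..b} \<Longrightarrow> (\<Sum>K\<in>D. Sup K - Inf K) < d2 \<Longrightarrow>
        (\<Sum>K\<in>D. norm (v (Sup K) - v (Inf K))) < e / (2 * C)"
    using v \<open>e / (2 * C) > 0\<close> unfolding abs_continuous_on_interval_def by meson
  show "\<exists>d>0. \<forall>D S. D division_of S \<longrightarrow> S \<subseteq> {a..b} \<longrightarrow> (\<Sum>K\<in>D. Sup K - Inf K) < d \<longrightarrow>
          (\<Sum>K\<in>D. norm (w (Sup K) - w (Inf K))) < e"
  proof (intro exI[of _ "min d1 d2"] conjI allI impI)
    show "min d1 d2 > 0" using d1(1) d2(1) by simp
    fix D S assume D: "D division_of S" and S: "S \<subseteq> {a..b}"
      and small: "(\<Sum>K\<in>D. Sup K - Inf K) < min d1 d2"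
    have "norm (w (Sup K) - w (Inf K))
        \<le> C * (norm (u (Sup K) - u (Inf K)) + norm (v (Sup K) - v (Inf K)))" if K: "K \<in> D" for K
    proof -
      obtain s t where "K = {s..t}" using division_ofD(4)[OF D K] by auto
      moreover have "K \<noteq> {}" using division_ofD(3)[OF D K] .
      moreover have "K \<subseteq> {a..b}" using division_ofD(2)[OF D K] S by simp
      ultimately show ?thesis by (intro le) auto
    qed
    then have "(\<Sum>K\<in>D. norm (w (Sup K) - w (Inf K)))
        \<le> (\<Sum>K\<in>D. C * (norm (u (Sup K) - u (Inf K)) + norm (v (Sup K) - v (Inf K))))"
      by (rule sum_mono)
    also have "\<dots> = C * ((\<Sum>K\<in>D. norm (u (Sup K) - u (Inf K)))
        + (\<Sum>K\<in>D. norm (v (Sup K) - v (Inf K))))"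
      by (simp only: sum_distrib_left sum.distrib distrib_left)
    also have "\<dots> < C * (e / (2 * C) + e / (2 * C))"
      using d1(2)[OF D S] d2(2)[OF D S] small \<open>C > 0\<close>
      by (intro mult_strict_left_mono add_strict_mono) auto
    also have "\<dots> = e" using \<open>C > 0\<close> by simp
    finally show "(\<Sum>K\<in>D. norm (w (Sup K) - w (Inf K))) < e" .
  qed
qed

lemma abs_continuous_add:
  assumes "abs_continuous_on_interval a b u" "abs_continuous_on_interval a b v"
  shows "abs_continuous_on_interval a b (\<lambda>t. u t + v t)"
  by (rule abs_continuous_controlled[OF assms, of 1])
     (simp_all add: add_diff_add norm_triangle_ineq)

lemma abs_continuous_bilinear:
  fixes h :: "'a::real_normed_vector \<Rightarrow> 'b::real_normed_vector \<Rightarrow> 'c::real_normed_vector"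
  assumes h: "bounded_bilinear h"
    and u: "abs_continuous_on_interval a b u" and v: "abs_continuous_on_interval a b v"
  shows "abs_continuous_on_interval a b (\<lambda>t. h (u t) (v t))"
proof -
  interpret bounded_bilinear h by (rule h)
  obtain K where K: "K > 0" "\<And>x y. norm (h x y) \<le> norm x * norm y * K"
    using pos_bounded by blast
  obtain B where B: "B > 0" "\<And>t. t \<in> {a..b} \<Longrightarrow> norm (u t) \<le> B"
    using abs_continuous_bounded[OF u] by metis
  obtain C where C: "C > 0" "\<And>t. t \<in> {a..b} \<Longrightarrow> norm (v t) \<le> C"
    using abs_continuous_bounded[OF v] by metis
  show ?thesis
  proof (rule abs_continuous_controlled[OF u v, of "(B + C) * K"])
    fix s t assume st: "s \<in> {a..b}" "t \<in> {a..b}"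
    have "h (u t) (v t) - h (u s) (v s) = h (u t - u s) (v t) + h (u s) (v t - v s)"
      by (simp add: diff_left diff_right)
    then have "norm (h (u t) (v t) - h (u s) (v s))
        \<le> norm (h (u t - u s) (v t)) + norm (h (u s) (v t - v s))"
      by (simp add: norm_triangle_ineq)
    also have "\<dots> \<le> norm (u t - u s) * norm (v t) * K + norm (u s) * norm (v t - v s) * K"
      by (intro add_mono K)
    also have "\<dots> \<le> norm (u t - u s) * (B + C) * K + (B + C) * norm (v t - v s) * K"
      using B(1) C(1) K(1) B(2)[OF st(1)] C(2)[OF st(2)]
      by (intro add_mono mult_right_mono mult_left_mono) auto
    finally show "norm (h (u t) (v t) - h (u s) (v s))
        \<le> (B + C) * K * (norm (u t - u s) + norm (v t - v s))"
      by (simp add: algebra_simps)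
  qed (use B C K in simp)
qed

lemma abs_continuous_ident: "abs_continuous_on_interval a b (\<lambda>t. t)"
  unfolding abs_continuous_on_interval_def
proof (intro allI impI)
  fix e :: real assume "e > 0"
  show "\<exists>d>0. \<forall>D S. D division_of S \<longrightarrow> S \<subseteq> {a..b} \<longrightarrow> (\<Sum>K\<in>D. Sup K - Inf K) < d \<longrightarrow>
          (\<Sum>K\<in>D. norm (Sup K - Inf K)) < e"
  proof (intro exI[of _ e] conjI allI impI \<open>e > 0\<close>)
    fix D S assume D: "D division_of S" and small: "(\<Sum>K\<in>D. Sup K - Inf K) < e"
    have "norm (Sup K - Inf K) = Sup K - Inf K" if K: "K \<in> D" for K :: "real set"
    proof -
      obtain s t where "K = {s..t}" using division_ofD(4)[OF D K] by auto
      moreover have "K \<noteq> {}" using division_ofD(3)[OF D K] .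
      ultimately show ?thesis by simp
    qed
    then show "(\<Sum>K\<in>D. norm (Sup K - Inf K)) < e" using small by simp
  qed
qed

lemma abs_continuous_C1:
  fixes u :: "real \<Rightarrow> 'a::real_normed_vector"
  assumes deriv: "\<And>t. t \<in> {a..b} \<Longrightarrow> (u has_vector_derivative u' t) (at t within {a..b})"
    and cont: "continuous_on {a..b} u'"
  shows "abs_continuous_on_interval a b u"
proof -
  have "bounded (u' ` {a..b})"
    by (intro compact_imp_bounded compact_continuous_image cont) simp
  then obtain B where B: "B > 0" "\<And>t. t \<in> {a..b} \<Longrightarrow> norm (u' t) \<le> B"
    by (auto simp: bounded_pos)
  show ?thesis
  proof (rule abs_continuous_controlled[OF abs_continuous_ident abs_continuous_ident B(1)])
    fix s t assume st: "s \<in> {a..b}" "t \<in> {a..b}"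
    have "norm (u t - u s) \<le> B * norm (t - s)"
    proof (rule differentiable_bound[where S = "{a..b}" and f' = "\<lambda>t h. h *\<^sub>R u' t"])
      show "(u has_derivative (\<lambda>h. h *\<^sub>R u' z)) (at z within {a..b})" if "z \<in> {a..b}" for z
        using deriv[OF that] by (simp add: has_vector_derivative_def)
      show "onorm (\<lambda>h. h *\<^sub>R u' z) \<le> B" if "z \<in> {a..b}" for z
        using B(1) B(2)[OF that]
        by (intro onorm_bound) (auto simp: mult.commute[of B] intro: mult_left_mono)
    qed (use st in auto)
    also have "\<dots> \<le> B * (norm (t - s) + norm (t - s))" using B(1) by simp
    finally show "norm (u t - u s) \<le> B * (norm (t - s) + norm (t - s))" .
  qed
qed

lemma abs_continuous_C1_halfline:
  fixes u :: "real \<Rightarrow> 'a::real_normed_vector"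
  assumes "c \<le> a"
    and deriv: "\<And>t. t \<ge> c \<Longrightarrow> (u has_vector_derivative u' t) (at t within {c..})"
    and cont: "continuous_on {c..} u'"
  shows "abs_continuous_on_interval a b u"
proof (rule abs_continuous_C1)
  show "(u has_vector_derivative u' t) (at t within {a..b})" if "t \<in> {a..b}" for t
    by (rule has_vector_derivative_within_subset[where S = "{c..}"])
       (use \<open>c \<le> a\<close> that in \<open>auto intro: deriv\<close>)
  show "continuous_on {a..b} u'"
    by (rule continuous_on_subset[OF cont]) (use \<open>c \<le> a\<close> in auto)
qed


section \<open>Integral inequalities on a half-line\<close>

lemma abs_continuous_increment_le:
  fixes E h :: "real \<Rightarrow> real"
  assumes "a \<le> b" "abs_continuous_on_interval a b E" "negligible Z"
    and deriv: "\<And>t. t \<in> {a..b} - Z \<Longrightarrow>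
      \<exists>E'. (E has_vector_derivative E') (at t within {a..b}) \<and> E' \<le> h t"
    and h: "h integrable_on {a..b}"
  shows "E b - E a \<le> integral {a..b} h"
proof -
  obtain E' where E': "\<And>t. t \<in> {a..b} - Z \<Longrightarrow> (E has_vector_derivative E' t) (at t within {a..b})"
    "\<And>t. t \<in> {a..b} - Z \<Longrightarrow> E' t \<le> h t"
    using deriv by metis
  have "(E' has_integral (E b - E a)) {a..b}"
    by (rule fundamental_theorem_of_calculus_absolutely_continuous[OF assms(1-3) E'(1)])
  then have "((\<lambda>t. if t \<in> Z then h t else E' t) has_integral (E b - E a)) {a..b}"
    by (rule has_integral_spike[OF assms(3), rotated]) simp
  then show ?thesis
    by (rule has_integral_le[OF _ integrable_integral[OF h]]) (use E'(2) in auto)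
qed

text \<open>
  The integrals over \<open>[T, s]\<close> are bounded, so from some \<open>T'\<close> on they are within \<open>e\<close> of their supremum.
\<close>

lemma integral_tail_le:
  fixes k :: "real \<Rightarrow> real"
  assumes k: "k integrable_on {T..}" and nonneg: "\<And>t. t \<ge> T \<Longrightarrow> k t \<ge> 0" and "e > 0"
  obtains T' where "T' \<ge> T" "\<And>s. s \<ge> T' \<Longrightarrow> integral {T'..s} k \<le> e"
proof -
  have int: "k integrable_on {a..b}" if "T \<le> a" for a b
    using that by (intro integrable_on_subinterval[OF k]) auto
  define X where "X = (\<lambda>s. integral {T..s} k) ` {T..}"
  have "integral {T..s} k \<le> integral {T..} k" for s
    by (intro integral_subset_le int k) (use nonneg in auto)
  then have bdd: "bdd_above X" by (auto simp: X_def bdd_above_def)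
  obtain T' where T': "T' \<ge> T" "Sup X - e < integral {T..T'} k"
    using less_cSup_iff[OF _ bdd, of "Sup X - e"] \<open>e > 0\<close> by (auto simp: X_def)
  show thesis
  proof (rule that[OF T'(1)])
    fix s assume "s \<ge> T'"
    have "integral {T..T'} k + integral {T'..s} k = integral {T..s} k"
      using T'(1) \<open>s \<ge> T'\<close> by (intro Henstock_Kurzweil_Integration.integral_combine int) auto
    moreover have "integral {T..s} k \<le> Sup X"
      using T'(1) \<open>s \<ge> T'\<close> by (intro cSup_upper bdd) (auto simp: X_def)
    ultimately show "integral {T'..s} k \<le> e" using T'(2) by simp
  qed
qed

text \<open>
  A Gronwall lemma for an energy \<open>E\<close> with dissipation \<open>D\<close>. Instead of an integrating factor it uses
  a time \<open>T'\<close> after which \<open>k\<close> has total mass at most \<open>1/2\<close>: if \<open>m\<close> is the maximum of \<open>E\<close> on a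
  compact interval \<open>[T', t]\<close>, integration up to the maximum point gives
  \<open>m \<le> E T' + (1 + m) / 2\<close>, hence a bound on \<open>m\<close> that does not depend on \<open>t\<close>. With \<open>E\<close> bounded,
  a second integration bounds the total dissipation.
\<close>

lemma absolutely_continuous_gronwall:
  fixes E k D :: "real \<Rightarrow> real"
  assumes k: "k integrable_on {T..}" and k0: "\<And>t. t \<ge> T \<Longrightarrow> k t \<ge> 0"
    and E: "\<And>a b. T \<le> a \<Longrightarrow> a \<le> b \<Longrightarrow> abs_continuous_on_interval a b E"
    and E0: "\<And>t. t \<ge> T \<Longrightarrow> E t \<ge> 0"
    and D: "continuous_on {T..} D" and D0: "\<And>t. t \<ge> T \<Longrightarrow> D t \<ge> 0"
    and Z: "negligible Z"
    and deriv: "\<And>t. t \<ge> T \<Longrightarrow> t \<notin> Z \<Longrightarrow>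
      \<exists>E'. (E has_vector_derivative E') (at t within {T..}) \<and> E' \<le> k t * (1 + E t) - D t"
  obtains T' M where "T' \<ge> T" "\<And>s. s \<ge> T' \<Longrightarrow> E s \<le> M" "\<And>s. s \<ge> T' \<Longrightarrow> integral {T'..s} D \<le> M"
proof -
  obtain T' where T': "T' \<ge> T" "\<And>s. s \<ge> T' \<Longrightarrow> integral {T'..s} k \<le> 1 / 2"
    using integral_tail_le[OF k k0, of "1 / 2"] by auto
  have intk: "k integrable_on {T'..b}" for b
    using T'(1) by (intro integrable_on_subinterval[OF k]) auto
  have intD: "D integrable_on {T'..b}" for b
    using T'(1) by (intro integrable_continuous_interval continuous_on_subset[OF D]) auto
  have incr: "E s - E T' \<le> (1 + m) * integral {T'..s} k - integral {T'..s} D"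
    if s: "s \<ge> T'" and m: "\<And>t. t \<in> {T'..s} \<Longrightarrow> E t \<le> m" for s m
  proof -
    have "E s - E T' \<le> integral {T'..s} (\<lambda>t. (1 + m) * k t - D t)"
    proof (rule abs_continuous_increment_le[OF s E[OF T'(1) s] Z])
      fix t assume t: "t \<in> {T'..s} - Z"
      then obtain E' where E': "(E has_vector_derivative E') (at t within {T..})"
        "E' \<le> k t * (1 + E t) - D t"
        using deriv[of t] T'(1) by auto
      have "k t * (1 + E t) \<le> k t * (1 + m)"
        using m[of t] k0[of t] t T'(1) by (intro mult_left_mono) auto
      then have "E' \<le> (1 + m) * k t - D t" using E'(2) by (simp add: mult.commute)
      moreover have "(E has_vector_derivative E') (at t within {T'..s})"
        by (rule has_vector_derivative_within_subset[OF E'(1)]) (use T'(1) in auto)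
      ultimately show "\<exists>E'. (E has_vector_derivative E') (at t within {T'..s}) \<and> E' \<le> (1 + m) * k t - D t"
        by blast
    qed (intro integrable_diff integrable_on_mult_right intk intD)
    also have "\<dots> = (1 + m) * integral {T'..s} k - integral {T'..s} D"
      by (subst integral_diff) (auto intro!: integrable_on_mult_right intk intD)
    finally show ?thesis .
  qed
  have intD0: "integral {T'..s} D \<ge> 0" for s
    by (rule integral_nonneg[OF intD]) (use D0 T'(1) in auto)
  have bound: "E t \<le> 2 * E T' + 1" if t: "t \<ge> T'" for t
  proof -
    obtain m where m: "m \<in> {T'..t}" "\<And>s. s \<in> {T'..t} \<Longrightarrow> E s \<le> E m"
      using continuous_attains_sup[of "{T'..t}" E] t
        abs_continuous_imp_continuous_on[OF E[OF T'(1) t]] by auto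
    \<comment> \<open>Integration only up to the maximum point absorbs the right-hand side.\<close>
    have "E m - E T' \<le> (1 + E m) * integral {T'..m} k - integral {T'..m} D"
      using m by (intro incr) auto
    also have "\<dots> \<le> (1 + E m) * (1 / 2) - 0"
      using T' m E0[of m] intD0 by (intro diff_mono mult_left_mono) auto
    finally show ?thesis using m(2)[of t] t by simp
  qed
  show thesis
  proof (rule that[OF T'(1) bound])
    fix s assume s: "s \<ge> T'"
    have "E s - E T' \<le> (1 + (2 * E T' + 1)) * integral {T'..s} k - integral {T'..s} D"
      using s bound by (intro incr) auto
    also have "\<dots> \<le> (1 + (2 * E T' + 1)) * (1 / 2) - integral {T'..s} D"
      using T' s E0[of T'] by (intro diff_right_mono mult_left_mono) auto
    finally show "integral {T'..s} D \<le> 2 * E T' + 1" using E0[of s] s T'(1) by (simp add: add_divide_distrib)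
  qed
qed

lemma absolutely_integrable_from_bounded_integrals:
  fixes D :: "real \<Rightarrow> real"
  assumes D: "continuous_on {T..} D" and D0: "\<And>t. t \<ge> T \<Longrightarrow> D t \<ge> 0" and "T \<le> T'"
    and M: "\<And>s. s \<ge> T' \<Longrightarrow> integral {T'..s} D \<le> M"
  shows "D absolutely_integrable_on {T..}"
proof -
  have int: "D integrable_on {a..b}" if "T \<le> a" for a b
    using that by (intro integrable_continuous_interval continuous_on_subset[OF D]) auto
  have bound: "0 \<le> integral {T..b} D \<and> integral {T..b} D \<le> integral {T..T'} D + \<bar>M\<bar>" for b
  proof (cases "b \<ge> T'")
    case True
    have "integral {T..T'} D + integral {T'..b} D = integral {T..b} D"
      using True \<open>T \<le> T'\<close> by (intro Henstock_Kurzweil_Integration.integral_combine int) auto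
    then show ?thesis using M[OF True] integral_nonneg[OF int[of T b]] D0 by auto
  next
    case False
    have "integral {T..b} D \<le> integral {T..T'} D"
      by (intro integral_subset_le int) (use False D0 in auto)
    then show ?thesis using integral_nonneg[OF int[of T b]] D0 by auto
  qed
  define f where "f n t = (if t \<in> {T..real n} then D t else 0)" for n t
  have f: "(f n has_integral integral {T..real n} D) {T..}" for n
    unfolding f_def
    by (subst has_integral_restrict) (auto intro: integrable_integral int)
  have "D integrable_on {T..} \<and> (\<lambda>n. integral {T..} (f n)) \<longlonglongrightarrow> integral {T..} D"
  proof (intro monotone_convergence_increasing allI ballI)
    show "f n integrable_on {T..}" for n using f by blast
    show "f n t \<le> f (Suc n) t" if "t \<in> {T..}" for n t using D0 that by (auto simp: f_def)
    show "(\<lambda>n. f n t) \<longlonglongrightarrow> D t" if "t \<in> {T..}" for t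
    proof (rule tendsto_eventually)
      show "\<forall>\<^sub>F n in sequentially. f n t = D t"
        using eventually_ge_at_top[of "nat \<lceil>t\<rceil>"]
        by eventually_elim (use that in \<open>auto simp: f_def nat_ceiling_le_eq\<close>)
    qed
    show "bounded (range (\<lambda>n. integral {T..} (f n)))"
      using bound integral_unique[OF f] by (auto intro!: boundedI[of _ "integral {T..T'} D + \<bar>M\<bar>"])
  qed
  then show ?thesis
    using D0 by (intro nonnegative_absolutely_integrable_1) auto
qed

section \<open>The Lyapunov argument\<close>

text \<open>
  The differential inequality for the energy at a fixed time. Here \<open>u\<close>, \<open>P\<close>, \<open>z\<close>, \<open>q\<close>, \<open>w2\<close>, \<open>L1\<close>
  stand for \<open>t\<^sup>r\<close>, \<open>t\<close> to the power \<open>(r+1)/2\<close>, the deviation \<open>w - w\<^sub>*\<close>, the velocity, the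
  acceleration, and the derivative of the gap \<open>L\<close>; the left-hand side is what the product rule
  yields for the energy, the inner bracket on the right. Its weights are tuned so that the terms
  with \<open>L1\<close> cancel; the damping \<open>- 2 r0 \<alpha> (v \<bullet> q)\<close> cancels the derivative of \<open>r0 \<alpha> (z \<bullet> z)\<close> and
  leaves \<open>- \<alpha> t (q \<bullet> q)\<close>; and the factor in front of the perturbation
  is the square root of the coefficient of \<open>L\<close> in the energy. The cross term \<open>z \<bullet> q\<close> of lower order is
  split by Young's inequality into a fraction of \<open>\<alpha> t (q \<bullet> q)\<close> and an \<open>O(1/t\<^sup>2)\<close> multiple of the
  energy; for large \<open>t\<close> the kinetic term of order \<open>u\<close> is absorbed as well.
\<close>

lemma lyapunov_derivative_le:
  fixes z q w2 v :: "'a::real_inner" and t u P r r0 \<alpha> L L1 \<rho> N :: real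
  assumes t: "t \<ge> 1" and u: "0 < u" "u \<le> 1" and P: "P > 0" "P\<^sup>2 = t * u" and "r \<le> 1"
    and pos: "r0 > 0" "\<alpha> > 0" and large: "4 * (2 * r0 + 1) \<le> \<alpha> * t" and L: "L \<ge> 0" and N: "N \<ge> 0"
    and v: "v = z + (t / (2 * r0)) *\<^sub>R q"
    and diss: "v \<bullet> (w2 + (\<alpha> / u) *\<^sub>R q) \<le> - (t / (2 * r0)) * L1 - L - \<rho> / 2 + N * norm v"
  shows "(r + 1) * u * L + t * u * L1 + 2 * r0\<^sup>2 * ((r - 1) * u / t\<^sup>2) * (v \<bullet> v)
      + 4 * r0\<^sup>2 * (u / t) * (v \<bullet> (q + (1 / (2 * r0)) *\<^sub>R q + (t / (2 * r0)) *\<^sub>R w2))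
      + 2 * r0 * \<alpha> * (z \<bullet> q)
    \<le> ((4 * r0\<^sup>2 + 2 * r0)\<^sup>2 / (r0 * \<alpha>\<^sup>2) / t\<^sup>2 + P * N)
        * (1 + (t * u * L + 2 * r0\<^sup>2 * (u / t) * (v \<bullet> v) + r0 * \<alpha> * (z \<bullet> z)))
      - ((2 * r0 - r - 1) * u * L + r0 * u * \<rho> + \<alpha> / 2 * t * (q \<bullet> q))"
proof -
  have [simp]: "t \<noteq> 0" "u \<noteq> 0" "r0 \<noteq> 0" "\<alpha> \<noteq> 0" using t u pos by auto
  have t0: "t > 0" using t by simp
  define K where "K = 4 * r0\<^sup>2 + 2 * r0"
  define E where "E = t * u * L + 2 * r0\<^sup>2 * (u / t) * (v \<bullet> v) + r0 * \<alpha> * (z \<bullet> z)"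
  have parts: "t * u * L \<ge> 0" "2 * r0\<^sup>2 * (u / t) * (v \<bullet> v) \<ge> 0" "r0 * \<alpha> * (z \<bullet> z) \<ge> 0"
    using t0 u pos L by simp_all
  \<comment> \<open>The acceleration is traded for the force plus damping.\<close>
  have expand: "4 * r0\<^sup>2 * (u / t) * (v \<bullet> (q + (1 / (2 * r0)) *\<^sub>R q + (t / (2 * r0)) *\<^sub>R w2))
      = 2 * r0 * u * (v \<bullet> (w2 + (\<alpha> / u) *\<^sub>R q)) + K * (u / t) * (v \<bullet> q) - 2 * r0 * \<alpha> * (v \<bullet> q)"
    using t0 u pos by (simp add: inner_add_right K_def field_simps power2_eq_square)
  have vq: "v \<bullet> q = z \<bullet> q + t / (2 * r0) * (q \<bullet> q)"
    by (simp add: v inner_add_left)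
  have force: "2 * r0 * u * (v \<bullet> (w2 + (\<alpha> / u) *\<^sub>R q))
      \<le> - (t * u * L1) - 2 * r0 * u * L - r0 * u * \<rho> + 2 * (r0 * u * norm v) * N"
  proof -
    have "2 * r0 * u * (v \<bullet> (w2 + (\<alpha> / u) *\<^sub>R q))
        \<le> 2 * r0 * u * (- (t / (2 * r0)) * L1 - L - \<rho> / 2 + N * norm v)"
      using u pos by (intro mult_left_mono diss) simp_all
    also have "\<dots> = - (t * u * L1) - 2 * r0 * u * L - r0 * u * \<rho> + 2 * (r0 * u * norm v) * N"
      using pos by (simp add: field_simps)
    finally show ?thesis .
  qed
  have perturb: "2 * (r0 * u * norm v) * N \<le> P * N * (1 + E)"
  proof -
    \<comment> \<open>The choice that makes \<open>2 y\<^sup>2\<close> the part of the energy carried by \<open>v\<close>.\<close>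
    define y where "y = r0 * norm v * u / P"
    have "y\<^sup>2 = r0\<^sup>2 * (norm v)\<^sup>2 * u\<^sup>2 / (t * u)"
      by (simp add: y_def power_mult_distrib power_divide P(2))
    also have "\<dots> = r0\<^sup>2 * (u / t) * (v \<bullet> v)"
      by (simp add: dot_square_norm power2_eq_square)
    finally have "2 * y\<^sup>2 \<le> E" using parts by (simp add: E_def)
    moreover have "2 * y \<le> 1 + y\<^sup>2" using zero_le_power2[of "y - 1"] by (simp add: power2_eq_square algebra_simps)
    moreover have "y\<^sup>2 \<ge> 0" by simp
    ultimately have "2 * y \<le> 1 + E" by linarith
    then have "P * N * (2 * y) \<le> P * N * (1 + E)"
      using P N by (intro mult_left_mono) auto
    moreover have "P * N * (2 * y) = 2 * (r0 * u * norm v) * N"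
      using P by (simp add: y_def)
    ultimately show ?thesis by simp
  qed
  have cross: "K * (u / t) * (z \<bullet> q) \<le> \<alpha> / 4 * t * (q \<bullet> q) + K\<^sup>2 / (r0 * \<alpha>\<^sup>2) / t\<^sup>2 * (1 + E)"
  proof -
    define X where "X = K * (u / t) * norm z"
    have "K > 0" using pos by (simp add: K_def add_pos_pos)
    have "K * (u / t) * (z \<bullet> q) \<le> X * norm q"
    proof -
      have "K * (u / t) * (z \<bullet> q) \<le> K * (u / t) * (norm z * norm q)"
        using \<open>K > 0\<close> u t0 by (intro mult_left_mono norm_cauchy_schwarz) simp
      then show ?thesis by (simp add: X_def mult.assoc)
    qed
    also have "\<dots> \<le> \<alpha> / 4 * t * (norm q)\<^sup>2 + X\<^sup>2 / (\<alpha> * t)"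
    proof -
      have "0 \<le> (\<alpha> * t * norm q / 2 - X)\<^sup>2 / (\<alpha> * t)" using pos t0 by simp
      also have "\<dots> = \<alpha> / 4 * t * (norm q)\<^sup>2 + X\<^sup>2 / (\<alpha> * t) - X * norm q"
        using t0 by (simp add: power2_eq_square field_simps)
      finally show ?thesis by simp
    qed
    also have "X\<^sup>2 / (\<alpha> * t) \<le> K\<^sup>2 / (r0 * \<alpha>\<^sup>2) / t\<^sup>2 * (1 + E)"
    proof -
      have "u\<^sup>2 / t \<le> 1"
        using u t power_le_one[of u 2] by (simp add: divide_le_eq)
      have "X\<^sup>2 / (\<alpha> * t) = K\<^sup>2 / (r0 * \<alpha>\<^sup>2) / t\<^sup>2 * (r0 * \<alpha> * (z \<bullet> z) * (u\<^sup>2 / t))"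
        using pos t0 by (simp add: X_def dot_square_norm power2_eq_square field_simps)
      also have "\<dots> \<le> K\<^sup>2 / (r0 * \<alpha>\<^sup>2) / t\<^sup>2 * (r0 * \<alpha> * (z \<bullet> z) * 1)"
        using pos \<open>u\<^sup>2 / t \<le> 1\<close> by (intro mult_left_mono) auto
      also have "\<dots> \<le> K\<^sup>2 / (r0 * \<alpha>\<^sup>2) / t\<^sup>2 * (1 + E)"
        using pos parts by (intro mult_left_mono) (auto simp: E_def)
      finally show ?thesis .
    qed
    finally show ?thesis by (simp add: dot_square_norm)
  qed
  have kinetic: "K * (u / t) * (t / (2 * r0) * (q \<bullet> q)) \<le> \<alpha> / 4 * t * (q \<bullet> q)"
  proof -
    have "K * (u / t) * (t / (2 * r0) * (q \<bullet> q)) = (2 * r0 + 1) * u * (q \<bullet> q)"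
      using pos t0 by (simp add: K_def power2_eq_square field_simps)
    also have "\<dots> \<le> (2 * r0 + 1) * 1 * (q \<bullet> q)"
      using pos u by (intro mult_right_mono mult_left_mono) auto
    also have "\<dots> \<le> \<alpha> / 4 * t * (q \<bullet> q)"
      using large by (intro mult_right_mono) auto
    finally show ?thesis .
  qed
  have damp: "2 * r0 * \<alpha> * (v \<bullet> q) = 2 * r0 * \<alpha> * (z \<bullet> q) + \<alpha> * t * (q \<bullet> q)"
    by (simp add: vq field_simps)
  have Kvq: "K * (u / t) * (v \<bullet> q) = K * (u / t) * (z \<bullet> q) + K * (u / t) * (t / (2 * r0) * (q \<bullet> q))"
    by (simp only: vq distrib_left)
  have shrink: "2 * r0\<^sup>2 * ((r - 1) * u / t\<^sup>2) * (v \<bullet> v) \<le> 0"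
    using \<open>r \<le> 1\<close> u by (intro mult_nonpos_nonneg mult_nonneg_nonpos divide_nonpos_nonneg mult_nonpos_nonneg) auto
  have gain: "(2 * r0 - r - 1) * u * L = 2 * r0 * u * L - (r + 1) * u * L"
    by (simp add: algebra_simps)
  have half: "\<alpha> * t * (q \<bullet> q) = \<alpha> / 4 * t * (q \<bullet> q) + \<alpha> / 4 * t * (q \<bullet> q) + \<alpha> / 2 * t * (q \<bullet> q)"
    by simp
  show ?thesis
    unfolding E_def[symmetric] K_def[symmetric] expand gain distrib_right[of _ _ "1 + E"]
    using force perturb cross kinetic damp Kvq shrink half by linarith
qed

text \<open>
  The abstract form of the convergence argument. The only information on the dynamics is that the
  force, tested with \<open>w - c + \<delta> w'\<close>, dissipates the gap \<open>L\<close> and the residual \<open>\<rho>\<close> up to a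
  perturbation of size \<open>N\<close>. The energy
  \<open>t\<^sup>r\<^sup>+\<^sup>1 L + 2 r0\<^sup>2 t\<^sup>r\<^sup>-\<^sup>1 |w - c + \<delta> w'|\<^sup>2 + r0 \<alpha> |w - c|\<^sup>2\<close> satisfies the hypothesis of
  the Gronwall lemma, with a dissipation that dominates a multiple of each of the three integrands; it therefore stays
  bounded, which gives the pointwise rates, and the integral of the dissipation is finite.
\<close>

lemma lyapunov_decay:
  fixes w w' :: "real \<Rightarrow> 'a::euclidean_space" and c :: 'a and L L' \<rho> N :: "real \<Rightarrow> real"
    and t0 r r0 \<alpha> :: real
  assumes t0: "t0 \<ge> 1" and r: "-1 < r" "r \<le> 0" and \<alpha>: "\<alpha> > 0" and r0: "r0 > (r + 1) / 2"
    and w: "C1_with_locally_ac_deriv t0 w w'"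
    and L: "\<And>t. t \<ge> t0 \<Longrightarrow> (L has_vector_derivative L' t) (at t within {t0..})"
      "continuous_on {t0..} L'" "\<And>t. t \<ge> t0 \<Longrightarrow> L t \<ge> 0"
    and \<rho>: "continuous_on {t0..} \<rho>" "\<And>t. t \<ge> t0 \<Longrightarrow> \<rho> t \<ge> 0"
    and N: "\<And>t. N t \<ge> 0" "(\<lambda>t. t powr ((r + 1) / 2) * N t) integrable_on {t0..}"
    and Z: "negligible Z"
    and dyn: "\<And>t. t \<ge> t0 \<Longrightarrow> t \<notin> Z \<Longrightarrow> \<exists>w''. (w' has_vector_derivative w'') (at t within {t0..}) \<and>
      (w t - c + (t / (2 * r0)) *\<^sub>R w' t) \<bullet> (w'' + (\<alpha> / t powr r) *\<^sub>R w' t)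
        \<le> - (t / (2 * r0)) * L' t - L t - \<rho> t / 2 + N t * norm (w t - c + (t / (2 * r0)) *\<^sub>R w' t)"
  shows "\<exists>T M. \<forall>t\<ge>T. t powr (r + 1) * L t \<le> M \<and> t powr ((r + 1) / 2) * norm (w' t) \<le> M"
    and "(\<lambda>t. t powr r * L t) absolutely_integrable_on {t0..}"
    and "(\<lambda>t. t powr r * \<rho> t) absolutely_integrable_on {t0..}"
    and "(\<lambda>t. t * (norm (w' t))\<^sup>2) absolutely_integrable_on {t0..}"
proof -
  have r0_pos: "r0 > 0" and gap: "2 * r0 - r - 1 > 0" using r0 r by simp_all
  define u where "u t = t powr r" for t :: real
  define z where "z t = w t - c" for t
  define v where "v t = z t + (t / (2 * r0)) *\<^sub>R w' t" for t
  define E where "E t = t * u t * L t + 2 * r0\<^sup>2 * (u t / t) * (v t \<bullet> v t) + r0 * \<alpha> * (z t \<bullet> z t)" for t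
  define D where "D t = (2 * r0 - r - 1) * u t * L t + r0 * u t * \<rho> t + \<alpha> / 2 * t * (w' t \<bullet> w' t)" for t
  define C where "C = (4 * r0\<^sup>2 + 2 * r0)\<^sup>2 / (r0 * \<alpha>\<^sup>2)"
  define k where "k t = C / t\<^sup>2 + t powr ((r + 1) / 2) * N t" for t
  \<comment> \<open>From this time on the damping dominates the kinetic term of lower order.\<close>
  define T where "T = max t0 (4 * (2 * r0 + 1) / \<alpha>)"
  have T: "T \<ge> t0" "\<And>t. t \<ge> T \<Longrightarrow> 4 * (2 * r0 + 1) \<le> \<alpha> * t"
    using \<alpha> by (auto simp: T_def field_simps)
  have u: "0 < u t" "u t \<le> 1" if "t \<ge> t0" for t
    using that t0 r powr_mono[of r 0 t] by (auto simp: u_def)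
  have w_deriv: "(w has_vector_derivative w' t) (at t within {t0..})" if "t \<ge> t0" for t
    using w that by (simp add: C1_with_locally_ac_deriv_def)
  have w'_cont: "continuous_on {t0..} w'" using w by (simp add: C1_with_locally_ac_deriv_def)
  have L_cont: "continuous_on {t0..} L"
    using L(1) by (auto intro!: continuous_on_vector_derivative)
  have u_cont: "continuous_on {t0..} u"
    unfolding u_def using t0 by (intro continuous_intros) auto
  have z_deriv: "(z has_vector_derivative w' t) (at t within {t0..})" if "t \<ge> t0" for t
    unfolding z_def using w_deriv[OF that] by (auto intro!: derivative_eq_intros)
  have u_deriv: "(u has_real_derivative r * u t / t) (at t within {t0..})" if "t \<ge> t0" for t
  proof -
    have "((\<lambda>s. s powr r) has_real_derivative r * t powr (r - 1)) (at t within {t0..})"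
      using that t0 by (intro has_real_derivative_powr[THEN has_field_derivative_at_within]) simp
    moreover have "r * t powr (r - 1) = r * u t / t"
      using that t0 by (simp add: u_def powr_diff)
    ultimately show ?thesis by (simp add: u_def[abs_def])
  qed
  have E_ac: "abs_continuous_on_interval a b E" if ab: "t0 \<le> a" "a \<le> b" for a b
  proof -
    have id: "abs_continuous_on_interval a b (\<lambda>t. t)"
      by (rule abs_continuous_ident)
    have const: "abs_continuous_on_interval a b (\<lambda>t. d)" for d :: real
      by (rule abs_continuous_C1_halfline[where c = t0 and u' = "\<lambda>_. 0"]) (use ab in auto)
    have uac: "abs_continuous_on_interval a b u"
    proof (rule abs_continuous_C1_halfline[where c = t0 and u' = "\<lambda>t. r * u t / t"])
      show "continuous_on {t0..} (\<lambda>t. r * u t / t)"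
        using t0 by (intro continuous_intros u_cont) auto
    qed (use ab u_deriv in \<open>auto simp: has_real_derivative_iff_has_vector_derivative\<close>)
    have "abs_continuous_on_interval a b (\<lambda>t. 1 / t)"
    proof (rule abs_continuous_C1_halfline[where c = t0 and u' = "\<lambda>t. - 1 / t\<^sup>2"])
      show "continuous_on {t0..} (\<lambda>t::real. - 1 / t\<^sup>2)"
        using t0 by (intro continuous_intros) auto
      show "((\<lambda>t. 1 / t) has_vector_derivative - 1 / t\<^sup>2) (at t within {t0..})" if "t \<ge> t0" for t
        using that t0 unfolding has_real_derivative_iff_has_vector_derivative[symmetric]
        by (auto intro!: derivative_eq_intros simp: power2_eq_square)
    qed (rule ab)
    note mult = abs_continuous_bilinear[OF bounded_bilinear_mult]
    have ut: "abs_continuous_on_interval a b (\<lambda>t. u t / t)"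
      using mult[OF uac \<open>abs_continuous_on_interval a b (\<lambda>t. 1 / t)\<close>] by simp
    have zac: "abs_continuous_on_interval a b z"
      by (rule abs_continuous_C1_halfline[OF ab(1) z_deriv w'_cont])
    have w'ac: "abs_continuous_on_interval a b w'"
      using w ab by (simp add: C1_with_locally_ac_deriv_def)
    have "abs_continuous_on_interval a b (\<lambda>t. (t / (2 * r0)) *\<^sub>R w' t)"
      using abs_continuous_bilinear[OF bounded_bilinear_scaleR mult[OF const[of "1 / (2 * r0)"] id] w'ac]
      by simp
    then have vac: "abs_continuous_on_interval a b v"
      unfolding v_def[abs_def] by (rule abs_continuous_add[OF zac])
    note inner = abs_continuous_bilinear[OF bounded_bilinear_inner]
    have Lac: "abs_continuous_on_interval a b L"
      by (rule abs_continuous_C1_halfline[OF ab(1) L(1,2)])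
    show ?thesis
      unfolding E_def[abs_def]
      by (intro abs_continuous_add mult[OF mult[OF id uac] Lac]
          mult[OF mult[OF const ut] inner[OF vac vac]] mult[OF const inner[OF zac zac]])
  qed
  have E_parts: "t * u t * L t \<ge> 0" "2 * r0\<^sup>2 * (u t / t) * (v t \<bullet> v t) \<ge> 0" "r0 * \<alpha> * (z t \<bullet> z t) \<ge> 0"
    if "t \<ge> t0" for t
    using that t0 u[OF that] r0_pos \<alpha> L(3)[OF that] by simp_all
  have D_parts: "(2 * r0 - r - 1) * u t * L t \<ge> 0" "r0 * u t * \<rho> t \<ge> 0" "\<alpha> / 2 * t * (w' t \<bullet> w' t) \<ge> 0"
    if "t \<ge> t0" for t
    using that t0 u[OF that] r0_pos \<alpha> L(3)[OF that] \<rho>(2)[OF that] gap by simp_all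
  have D_cont: "continuous_on {t0..} D"
    unfolding D_def by (intro continuous_intros u_cont L_cont \<rho>(1) w'_cont)
  have "C \<ge> 0" using r0_pos by (simp add: C_def)
  have k_int: "k integrable_on {T..}"
  proof -
    have "(\<lambda>t. 1 / t ^ 2) integrable_on {T..}"
      using has_integral_inverse_power_to_inf[of 2 T] T(1) t0 by (auto simp: has_integral_iff)
    then have "(\<lambda>t. C * (1 / t ^ 2)) integrable_on {T..}"
      by (rule integrable_on_mult_right)
    moreover have "(\<lambda>t. t powr ((r + 1) / 2) * N t) integrable_on {T..}"
    proof -
      have "(\<lambda>t. t powr ((r + 1) / 2) * N t) absolutely_integrable_on {t0..}"
        using N by (intro nonnegative_absolutely_integrable_1) auto
      then have "(\<lambda>t. t powr ((r + 1) / 2) * N t) absolutely_integrable_on {T..}"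
        by (rule set_integrable_subset) (use T(1) in auto)
      then show ?thesis by (rule absolutely_integrable_on_def[THEN iffD1, THEN conjunct1])
    qed
    ultimately show ?thesis
      unfolding k_def by (simp add: integrable_add)
  qed
  have E_deriv: "\<exists>E'. (E has_vector_derivative E') (at t within {T..}) \<and> E' \<le> k t * (1 + E t) - D t"
    if t: "t \<ge> T" "t \<notin> Z" for t
  proof -
    have tt: "t \<ge> t0" "t > 0" using t T(1) t0 by auto
    obtain w'' where w'': "(w' has_vector_derivative w'') (at t within {t0..})"
      "v t \<bullet> (w'' + (\<alpha> / u t) *\<^sub>R w' t)
        \<le> - (t / (2 * r0)) * L' t - L t - \<rho> t / 2 + N t * norm (v t)"
      using dyn[OF tt(1) t(2)] unfolding v_def z_def u_def by blast
    define V where "V = w' t + (1 / (2 * r0)) *\<^sub>R w' t + (t / (2 * r0)) *\<^sub>R w''"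
    have scal: "((\<lambda>s. s / (2 * r0)) has_real_derivative 1 / (2 * r0)) (at t within {t0..})"
      using r0_pos by (auto intro!: derivative_eq_intros)
    have "(v has_vector_derivative V) (at t within {t0..})"
      unfolding v_def V_def
      using has_vector_derivative_add[OF z_deriv[OF tt(1)] has_vector_derivative_scaleR[OF scal w''(1)]]
      by (simp add: algebra_simps)
    note vv = bounded_bilinear.has_vector_derivative[OF bounded_bilinear_inner this this]
    have vv': "((\<lambda>s. v s \<bullet> v s) has_real_derivative 2 * (v t \<bullet> V)) (at t within {t0..})"
      using vv by (simp add: has_real_derivative_iff_has_vector_derivative inner_commute)
    note zz = bounded_bilinear.has_vector_derivative[OF bounded_bilinear_inner z_deriv[OF tt(1)] z_deriv[OF tt(1)]]
    have zz': "((\<lambda>s. z s \<bullet> z s) has_real_derivative 2 * (z t \<bullet> w' t)) (at t within {t0..})"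
      using zz by (simp add: has_real_derivative_iff_has_vector_derivative inner_commute)
    have L': "(L has_real_derivative L' t) (at t within {t0..})"
      using L(1)[OF tt(1)] by (simp add: has_real_derivative_iff_has_vector_derivative)
    define E' where "E' = (r + 1) * u t * L t + t * u t * L' t
      + 2 * r0\<^sup>2 * ((r - 1) * u t / t\<^sup>2) * (v t \<bullet> v t) + 4 * r0\<^sup>2 * (u t / t) * (v t \<bullet> V)
      + 2 * r0 * \<alpha> * (z t \<bullet> w' t)"
    have "(E has_real_derivative E') (at t within {t0..})"
      unfolding E_def E'_def using tt(2)
      by (auto intro!: derivative_eq_intros u_deriv[OF tt(1)] vv' zz' L' simp: field_simps power2_eq_square)
    then have "(E has_real_derivative E') (at t within {T..})"
      by (rule DERIV_subset) (use T(1) in auto)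
    moreover have "E' \<le> k t * (1 + E t) - D t"
      unfolding E'_def E_def D_def k_def C_def V_def
    proof (rule lyapunov_derivative_le[OF _ u[OF tt(1)] _ _ _ r0_pos \<alpha> T(2)[OF t(1)] L(3)[OF tt(1)] N(1) v_def w''(2)])
      show "(t powr ((r + 1) / 2))\<^sup>2 = t * u t"
        using tt(2) by (simp add: u_def power2_eq_square powr_add[symmetric] powr_mult_base add.commute)
    qed (use tt t0 r in auto)
    ultimately show ?thesis by (auto simp: has_real_derivative_iff_has_vector_derivative)
  qed
  obtain T' M where T': "T' \<ge> T" and E_le: "\<And>s. s \<ge> T' \<Longrightarrow> E s \<le> M"
    and D_le: "\<And>s. s \<ge> T' \<Longrightarrow> integral {T'..s} D \<le> M"
  proof (rule absolutely_continuous_gronwall[of k T E D Z])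
    show "k t \<ge> 0" if "t \<ge> T" for t using \<open>C \<ge> 0\<close> N(1) by (simp add: k_def)
    show "E t \<ge> 0" if "t \<ge> T" for t using E_parts[of t] that T(1) by (simp add: E_def)
    show "D t \<ge> 0" if "t \<ge> T" for t using D_parts[of t] that T(1) by (simp add: D_def)
    show "continuous_on {T..} D" by (rule continuous_on_subset[OF D_cont]) (use T(1) in auto)
    show "abs_continuous_on_interval a b E" if "T \<le> a" "a \<le> b" for a b
      using E_ac[of a b] that T(1) by simp
  qed (use k_int Z E_deriv in auto)
  have T'0: "T' \<ge> t0" using T' T(1) by simp
  have D_component: "G absolutely_integrable_on {t0..}"
    if "d > 0" "continuous_on {t0..} G" "\<And>t. t \<ge> t0 \<Longrightarrow> 0 \<le> G t" "\<And>t. t \<ge> t0 \<Longrightarrow> d * G t \<le> D t" for d G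
  proof (rule absolutely_integrable_from_bounded_integrals[OF that(2,3) T'0, of "M / d"])
    fix s assume s: "s \<ge> T'"
    have cont: "continuous_on {T'..s} G" "continuous_on {T'..s} D"
      by (rule continuous_on_subset[OF that(2)] continuous_on_subset[OF D_cont]; use T'0 in auto)+
    have "d * integral {T'..s} G = integral {T'..s} (\<lambda>t. d * G t)" by simp
    also have "\<dots> \<le> integral {T'..s} D"
      using that(4) T'0 by (intro integral_le integrable_continuous_interval continuous_intros cont) auto
    also have "\<dots> \<le> M" by (rule D_le[OF s])
    finally show "integral {T'..s} G \<le> M / d" using \<open>d > 0\<close> by (simp add: field_simps)
  qed simp
  show "(\<lambda>t. t powr r * L t) absolutely_integrable_on {t0..}"
  proof (rule D_component[OF gap])
    show "(2 * r0 - r - 1) * (t powr r * L t) \<le> D t" if "t \<ge> t0" for t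
      using D_parts[OF that] by (simp add: D_def u_def mult.assoc)
  qed (use L_cont u_cont L(3) in \<open>auto simp: u_def intro!: continuous_intros\<close>)
  show "(\<lambda>t. t powr r * \<rho> t) absolutely_integrable_on {t0..}"
  proof (rule D_component[OF r0_pos])
    show "r0 * (t powr r * \<rho> t) \<le> D t" if "t \<ge> t0" for t
      using D_parts[OF that] by (simp add: D_def u_def mult.assoc)
  qed (use u_cont \<rho> in \<open>auto simp: u_def intro!: continuous_intros\<close>)
  show "(\<lambda>t. t * (norm (w' t))\<^sup>2) absolutely_integrable_on {t0..}"
  proof (rule D_component[of "\<alpha> / 2"])
    show "\<alpha> / 2 * (t * (norm (w' t))\<^sup>2) \<le> D t" if "t \<ge> t0" for t
      using D_parts[OF that] by (simp add: D_def dot_square_norm mult.assoc)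
  qed (use \<alpha> t0 w'_cont in \<open>auto intro!: continuous_intros\<close>)
  have "t powr (r + 1) * L t \<le> M \<and>
      t powr ((r + 1) / 2) * norm (w' t) \<le> sqrt (4 * M + 8 * r0 * M / \<alpha>)" if "t \<ge> T'" for t
  proof
    have t: "t \<ge> t0" "t > 0" using that T'0 t0 by auto
    note parts = E_parts[OF t(1)]
    have "E t \<le> M" by (rule E_le[OF that])
    then have bounds: "t * u t * L t \<le> M" "2 * r0\<^sup>2 * (u t / t) * (v t \<bullet> v t) \<le> M" "r0 * \<alpha> * (z t \<bullet> z t) \<le> M"
      using parts by (simp_all add: E_def)
    show "t powr (r + 1) * L t \<le> M"
      using bounds(1) t by (simp add: u_def powr_add mult.commute)
    have ut: "u t / t \<le> 1" using u[OF t(1)] t t0 by (simp add: divide_le_eq)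
    \<comment> \<open>The velocity is recovered as a difference of two vectors controlled by the energy.\<close>
    have split: "t *\<^sub>R w' t = (2 * r0) *\<^sub>R (v t - z t)"
      using r0_pos by (simp add: v_def)
    have "(norm (v t - z t))\<^sup>2 \<le> 2 * (norm (v t))\<^sup>2 + 2 * (norm (z t))\<^sup>2"
    proof -
      have "(norm (v t - z t))\<^sup>2 \<le> (norm (v t) + norm (z t))\<^sup>2"
        by (intro power_mono norm_triangle_ineq4) simp
      also have "\<dots> \<le> 2 * (norm (v t))\<^sup>2 + 2 * (norm (z t))\<^sup>2"
        using zero_le_power2[of "norm (v t) - norm (z t)"] by (simp add: power2_eq_square algebra_simps)
      finally show ?thesis .
    qed
    then have vz: "(norm (v t - z t))\<^sup>2 \<le> 2 * (v t \<bullet> v t) + 2 * (z t \<bullet> z t)"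
      by (simp add: dot_square_norm)
    have "(t powr ((r + 1) / 2) * norm (w' t))\<^sup>2 = t * u t * (norm (w' t))\<^sup>2"
      using t by (simp add: u_def power_mult_distrib power2_eq_square powr_add[symmetric] powr_mult_base add.commute)
    also have "\<dots> = u t / t * (norm (t *\<^sub>R w' t))\<^sup>2"
      using t by (simp add: power_mult_distrib power2_eq_square)
    also have "\<dots> = 4 * r0\<^sup>2 * (u t / t) * (norm (v t - z t))\<^sup>2"
      unfolding split using t by (simp add: power_mult_distrib power2_eq_square)
    also have "\<dots> \<le> 4 * r0\<^sup>2 * (u t / t) * (2 * (v t \<bullet> v t) + 2 * (z t \<bullet> z t))"
      using u[OF t(1)] t by (intro mult_left_mono vz) simp
    also have "\<dots> = 4 * (2 * r0\<^sup>2 * (u t / t) * (v t \<bullet> v t)) + 8 * r0\<^sup>2 * (z t \<bullet> z t) * (u t / t)"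
      by (simp add: algebra_simps)
    also have "\<dots> \<le> 4 * M + 8 * r0\<^sup>2 * (z t \<bullet> z t) * 1"
      using bounds(2) by (intro add_mono mult_left_mono ut) auto
    also have "8 * r0\<^sup>2 * (z t \<bullet> z t) * 1 = 8 * r0 / \<alpha> * (r0 * \<alpha> * (z t \<bullet> z t))"
      using \<alpha> by (simp add: power2_eq_square)
    also have "4 * M + \<dots> \<le> 4 * M + 8 * r0 / \<alpha> * M"
      using \<alpha> r0_pos by (intro add_left_mono mult_left_mono bounds(3)) auto
    finally show "t powr ((r + 1) / 2) * norm (w' t) \<le> sqrt (4 * M + 8 * r0 * M / \<alpha>)"
      by (intro real_le_rsqrt) simp
  qed
  then have "\<forall>t\<ge>T'. t powr (r + 1) * L t \<le> max M (sqrt (4 * M + 8 * r0 * M / \<alpha>)) \<and>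
      t powr ((r + 1) / 2) * norm (w' t) \<le> max M (sqrt (4 * M + 8 * r0 * M / \<alpha>))"
    by (simp add: le_max_iff_disj)
  then show "\<exists>T M. \<forall>t\<ge>T. t powr (r + 1) * L t \<le> M \<and> t powr ((r + 1) / 2) * norm (w' t) \<le> M"
    by blast
qed

section \<open>Convexity and the augmented Lagrangian\<close>

text \<open>
  Restriction to the line through \<open>x\<close> and \<open>y\<close> reduces this to the one-dimensional case.
\<close>

lemma smooth_convex_above_tangent:
  assumes "smooth_convex f gradf"
  shows "f y \<ge> f x + gradf x \<bullet> (y - x)"
proof -
  define \<phi> where "\<phi> s = f (x + s *\<^sub>R (y - x))" for s :: real
  have f: "convex_on UNIV f" "GDERIV f x :> gradf x"
    using assms by (auto simp: smooth_convex_def)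
  have "convex_on UNIV \<phi>"
  proof (rule convex_onI)
    fix \<tau> s s' :: real assume \<tau>: "0 < \<tau>" "\<tau> < 1"
    have "x + ((1 - \<tau>) *\<^sub>R s + \<tau> *\<^sub>R s') *\<^sub>R (y - x)
        = (1 - \<tau>) *\<^sub>R (x + s *\<^sub>R (y - x)) + \<tau> *\<^sub>R (x + s' *\<^sub>R (y - x))"
      by (simp add: algebra_simps)
    then show "\<phi> ((1 - \<tau>) *\<^sub>R s + \<tau> *\<^sub>R s') \<le> (1 - \<tau>) * \<phi> s + \<tau> * \<phi> s'"
      using convex_onD[OF f(1), of \<tau> "x + s *\<^sub>R (y - x)" "x + s' *\<^sub>R (y - x)"] \<tau> by (simp add: \<phi>_def)
  qed simp
  moreover have "(\<phi> has_field_derivative gradf x \<bullet> (y - x)) (at 0)"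
  proof -
    have "((\<lambda>s::real. x + s *\<^sub>R (y - x)) has_derivative (\<lambda>s. s *\<^sub>R (y - x))) (at 0)"
      by (auto intro!: derivative_eq_intros)
    moreover have "(f has_derivative (\<lambda>h. h \<bullet> gradf x)) (at (x + 0 *\<^sub>R (y - x)))"
      using f(2) by (simp add: gderiv_def)
    ultimately have "(\<phi> has_derivative (\<lambda>s. (s *\<^sub>R (y - x)) \<bullet> gradf x)) (at 0)"
      unfolding \<phi>_def by (rule has_derivative_compose)
    then show ?thesis
      by (simp add: has_field_derivative_def inner_commute mult.commute[of _ "_ \<bullet> _"] mult_commute_abs)
  qed
  ultimately have "\<phi> 1 - \<phi> 0 \<ge> gradf x \<bullet> (y - x) * (1 - 0)"
    by (intro convex_on_imp_above_tangent[of UNIV]) auto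
  then show ?thesis by (simp add: \<phi>_def)
qed

text \<open>
  At a KKT point the tangent planes of \<open>f\<close> and \<open>g\<close> have slopes \<open>- A\<^sup>T ls\<close> and \<open>- B\<^sup>T ls\<close>, which is
  what the multiplier term compensates; the quadratic penalty is left over.
\<close>

lemma aug_lagrangian_gap_at_kkt:
  assumes "smooth_convex f gradf" "smooth_convex g gradg" and kkt: "(xs, ys, ls) \<in> kkt_set gradf gradg A B b"
  shows "aug_lagrangian f g A B b x y ls - aug_lagrangian f g A B b xs ys ls
    \<ge> 1 / 2 * (norm (A *v x + B *v y - b))\<^sup>2"
proof -
  have feas: "A *v xs + B *v ys - b = 0" and grads: "gradf xs = - (transpose A *v ls)" "gradg ys = - (transpose B *v ls)"
    using kkt by (auto simp: kkt_set_def)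
  have "ls \<bullet> (A *v x + B *v y - b) = ls \<bullet> (A *v x + B *v y - b) - ls \<bullet> (A *v xs + B *v ys - b)"
    using feas by simp
  also have "\<dots> = (transpose A *v ls) \<bullet> (x - xs) + (transpose B *v ls) \<bullet> (y - ys)"
    by (simp add: dot_lmul_matrix matrix_vector_mult_diff_distrib inner_diff_right inner_add_right)
  finally show ?thesis
    using smooth_convex_above_tangent[OF assms(1), of xs x] smooth_convex_above_tangent[OF assms(2), of ys y]
    by (simp add: aug_lagrangian_def grads feas)
qed

text \<open>
  The first-order inequality for the augmented Lagrangian, with slopes its partial gradients. The
  penalty is quadratic and vanishes at \<open>(xs, ys)\<close>, so its gradient tested with the deviation is
  twice its value; this is the source of the additional half of the squared residual.
\<close>

lemma aug_lagrangian_gradient_gap: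
  assumes "smooth_convex f gradf" "smooth_convex g gradg" and feas: "A *v xs + B *v ys - b = 0"
  shows "(gradf x + transpose A *v (ls + (A *v x + B *v y - b))) \<bullet> (x - xs)
      + (gradg y + transpose B *v (ls + (A *v x + B *v y - b))) \<bullet> (y - ys)
    \<ge> aug_lagrangian f g A B b x y ls - aug_lagrangian f g A B b xs ys ls
      + (norm (A *v x + B *v y - b))\<^sup>2 / 2"
proof -
  define \<rho> where "\<rho> = A *v x + B *v y - b"
  have "\<rho> = \<rho> - (A *v xs + B *v ys - b)" using feas by simp
  also have "\<dots> = A *v (x - xs) + B *v (y - ys)"
    by (simp add: \<rho>_def matrix_vector_mult_diff_distrib)
  finally have \<rho>: "A *v (x - xs) + B *v (y - ys) = \<rho>" by simp
  have "(transpose A *v (ls + \<rho>)) \<bullet> (x - xs) + (transpose B *v (ls + \<rho>)) \<bullet> (y - ys) = (ls + \<rho>) \<bullet> \<rho>"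
    by (simp add: dot_lmul_matrix \<rho>[symmetric] inner_add_right)
  also have "\<dots> = ls \<bullet> \<rho> + (norm \<rho>)\<^sup>2"
    by (simp add: inner_add_left dot_square_norm)
  finally show ?thesis
    using smooth_convex_above_tangent[OF assms(1), of x xs] smooth_convex_above_tangent[OF assms(2), of y ys]
    by (simp add: aug_lagrangian_def feas \<rho>_def[symmetric] inner_add_left inner_diff_right)
qed

lemma aug_lagrangian_has_vector_derivative:
  assumes "smooth_convex f gradf" "smooth_convex g gradg"
    and x: "(x has_vector_derivative x') (at t within S)" and y: "(y has_vector_derivative y') (at t within S)"
  shows "((\<lambda>t. aug_lagrangian f g A B b (x t) (y t) ls) has_vector_derivative
      ((gradf (x t) + transpose A *v (ls + (A *v x t + B *v y t - b))) \<bullet> x'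
      + (gradg (y t) + transpose B *v (ls + (A *v x t + B *v y t - b))) \<bullet> y')) (at t within S)"
proof -
  have comp: "((\<lambda>t. h (p t)) has_real_derivative gradh (p t) \<bullet> p') (at t within S)"
    if h: "smooth_convex h gradh" and p: "(p has_vector_derivative p') (at t within S)"
    for h :: "'z::euclidean_space \<Rightarrow> real" and gradh p p'
  proof -
    have "(h has_derivative (\<lambda>k. k \<bullet> gradh (p t))) (at (p t))"
      using h by (simp add: smooth_convex_def gderiv_def)
    from has_derivative_compose[OF p[unfolded has_vector_derivative_def] this]
    show ?thesis
      by (simp add: has_field_derivative_def inner_commute mult_commute_abs)
  qed
  define \<rho> where "\<rho> t = A *v x t + B *v y t - b" for t
  have \<rho>: "(\<rho> has_vector_derivative A *v x' + B *v y') (at t within S)"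
    unfolding \<rho>_def
    by (auto intro!: derivative_eq_intros bounded_linear.has_vector_derivative[OF matrix_vector_mul_bounded_linear] x y)
  have \<rho>2: "((\<lambda>t. (norm (\<rho> t))\<^sup>2) has_vector_derivative 2 * (\<rho> t \<bullet> (A *v x' + B *v y'))) (at t within S)"
    using bounded_bilinear.has_vector_derivative[OF bounded_bilinear_inner \<rho> \<rho>]
    by (simp add: dot_square_norm inner_commute)
  have l\<rho>: "((\<lambda>t. ls \<bullet> \<rho> t) has_vector_derivative ls \<bullet> (A *v x' + B *v y')) (at t within S)"
    by (rule bounded_linear.has_vector_derivative[OF bounded_linear_inner_right \<rho>])
  have "((\<lambda>t. f (x t) + g (y t) + ls \<bullet> \<rho> t + 1 / 2 * (norm (\<rho> t))\<^sup>2) has_real_derivative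
      (gradf (x t) \<bullet> x' + gradg (y t) \<bullet> y' + ls \<bullet> (A *v x' + B *v y') + \<rho> t \<bullet> (A *v x' + B *v y'))) (at t within S)"
    using has_vector_derivative_add[OF has_vector_derivative_add[OF has_vector_derivative_add[OF
        comp[OF assms(1) x, unfolded has_real_derivative_iff_has_vector_derivative]
        comp[OF assms(2) y, unfolded has_real_derivative_iff_has_vector_derivative]] l\<rho>]
        bounded_linear.has_vector_derivative[OF bounded_linear_mult_right \<rho>2, of "1 / 2"]]
    by (simp add: has_real_derivative_iff_has_vector_derivative)
  moreover have "gradf (x t) \<bullet> x' + gradg (y t) \<bullet> y' + ls \<bullet> (A *v x' + B *v y') + \<rho> t \<bullet> (A *v x' + B *v y')
    = (gradf (x t) + transpose A *v (ls + \<rho> t)) \<bullet> x' + (gradg (y t) + transpose B *v (ls + \<rho> t)) \<bullet> y'"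
    by (simp add: inner_add_left inner_add_right dot_lmul_matrix)
  ultimately show ?thesis
    by (simp add: aug_lagrangian_def \<rho>_def has_real_derivative_iff_has_vector_derivative)
qed

lemma C1_with_locally_ac_deriv_Pair:
  assumes u: "C1_with_locally_ac_deriv t0 u u'" and v: "C1_with_locally_ac_deriv t0 v v'"
  shows "C1_with_locally_ac_deriv t0 (\<lambda>t. (u t, v t)) (\<lambda>t. (u' t, v' t))"
  unfolding C1_with_locally_ac_deriv_def
proof (intro conjI allI impI)
  show "((\<lambda>t. (u t, v t)) has_vector_derivative (u' t, v' t)) (at t within {t0..})" if "t0 \<le> t" for t
    using u v that by (auto simp: C1_with_locally_ac_deriv_def intro: has_vector_derivative_Pair)
  show "continuous_on {t0..} (\<lambda>t. (u' t, v' t))"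
    using u v by (auto simp: C1_with_locally_ac_deriv_def intro!: continuous_intros)
  show "abs_continuous_on_interval a b (\<lambda>t. (u' t, v' t))" if "t0 \<le> a" "a \<le> b" for a b
  proof (rule abs_continuous_controlled)
    show "abs_continuous_on_interval a b u'" "abs_continuous_on_interval a b v'"
      using u v that by (simp_all add: C1_with_locally_ac_deriv_def)
    show "norm ((u' t, v' t) - (u' s, v' s)) \<le> 1 * (norm (u' t - u' s) + norm (v' t - v' s))" for s t
      by (simp add: norm_Pair_le)
  qed simp
qed

text \<open>
  The structural property of the primal-dual system. Since the same \<open>\<delta>\<close> extrapolates the
  primal variables in the multiplier equation and the multiplier in the primal equations, the
  coupling enters as \<open>- A\<^sup>T v3\<close>, \<open>- B\<^sup>T v3\<close> in the primal components and as \<open>A v1 + B v2\<close> in the dual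
  one, and these cancel when tested with \<open>v\<close>. What is left is the gradient of the augmented
  Lagrangian tested with \<open>z - z\<^sub>* + \<delta> z'\<close>, \<open>z = (x, y)\<close>: its velocity part is \<open>\<delta>\<close> times the
  derivative of the gap along the trajectory, its position part is bounded by convexity.
\<close>

lemma primal_dual_dissipation:
  fixes A :: "real^'n1^'m" and B :: "real^'n2^'m"
  assumes conv: "smooth_convex f gradf" "smooth_convex g gradg"
    and kkt: "(xs, ys, ls) \<in> kkt_set gradf gradg A B b"
    and F: "F1 = - gradf x - transpose A *v (l + \<delta> *\<^sub>R q3) - transpose A *v (A *v x + B *v y - b) + e1"
      "F2 = - gradg y - transpose B *v (l + \<delta> *\<^sub>R q3) - transpose B *v (A *v x + B *v y - b) + e2"
      "F3 = A *v (x + \<delta> *\<^sub>R q1) + B *v (y + \<delta> *\<^sub>R q2) - b"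
    and v: "v = (x, y, l) - (xs, ys, ls) + \<delta> *\<^sub>R (q1, q2, q3)"
  shows "v \<bullet> (F1, F2, F3)
    \<le> - \<delta> * ((gradf x + transpose A *v (ls + (A *v x + B *v y - b))) \<bullet> q1
          + (gradg y + transpose B *v (ls + (A *v x + B *v y - b))) \<bullet> q2)
      - (aug_lagrangian f g A B b x y ls - aug_lagrangian f g A B b xs ys ls)
      - (norm (A *v x + B *v y - b))\<^sup>2 / 2 + (norm e1 + norm e2) * norm v"
proof -
  define \<rho> where "\<rho> = A *v x + B *v y - b"
  define v1 v2 v3 where "v1 = x - xs + \<delta> *\<^sub>R q1" and "v2 = y - ys + \<delta> *\<^sub>R q2" and "v3 = l - ls + \<delta> *\<^sub>R q3"
  have v_eq: "v = (v1, v2, v3)" by (simp add: v v1_def v2_def v3_def)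
  have feas: "A *v xs + B *v ys - b = 0" using kkt by (simp add: kkt_set_def)
  define Gx Gy where "Gx = gradf x + transpose A *v (ls + \<rho>)" and "Gy = gradg y + transpose B *v (ls + \<rho>)"
  have "F3 = F3 - (A *v xs + B *v ys - b)" using feas by simp
  also have "\<dots> = A *v v1 + B *v v2"
    by (simp add: F(3) v1_def v2_def matrix_vector_mult_diff_distrib matrix_vector_right_distrib)
  finally have F3: "F3 = A *v v1 + B *v v2" .
  have F1: "F1 = e1 - Gx - transpose A *v v3"
    by (simp add: F(1) Gx_def v3_def \<rho>_def[symmetric] matrix_vector_mult_diff_distrib matrix_vector_right_distrib)
  have F2: "F2 = e2 - Gy - transpose B *v v3"
    by (simp add: F(2) Gy_def v3_def \<rho>_def[symmetric] matrix_vector_mult_diff_distrib matrix_vector_right_distrib)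
  have "v \<bullet> (F1, F2, F3) = (v1 \<bullet> e1 + v2 \<bullet> e2) - (Gx \<bullet> v1 + Gy \<bullet> v2)"
  proof -
    have "v1 \<bullet> (transpose A *v v3) = v3 \<bullet> (A *v v1)" "v2 \<bullet> (transpose B *v v3) = v3 \<bullet> (B *v v2)"
      by (metis dot_lmul_matrix inner_commute transpose_matrix_vector)+
    then show ?thesis
      by (simp add: v_eq F1 F2 F3 inner_diff_right inner_add_right inner_commute)
  qed
  also have "v1 \<bullet> e1 + v2 \<bullet> e2 \<le> norm v * norm e1 + norm v * norm e2"
  proof -
    have "norm v1 \<le> norm v" unfolding v_eq by (rule norm_fst_le)
    moreover have "norm v2 \<le> norm v"
      unfolding v_eq by (rule order_trans[OF norm_fst_le norm_snd_le])
    ultimately show ?thesis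
      by (intro add_mono order_trans[OF norm_cauchy_schwarz] mult_right_mono) auto
  qed
  also have "Gx \<bullet> v1 + Gy \<bullet> v2 = (Gx \<bullet> (x - xs) + Gy \<bullet> (y - ys)) + \<delta> * (Gx \<bullet> q1 + Gy \<bullet> q2)"
    by (simp add: v1_def v2_def inner_add_right algebra_simps)
  also have "norm v * norm e1 + norm v * norm e2 - \<dots> \<le> norm v * norm e1 + norm v * norm e2
      - ((aug_lagrangian f g A B b x y ls - aug_lagrangian f g A B b xs ys ls + (norm \<rho>)\<^sup>2 / 2)
         + \<delta> * (Gx \<bullet> q1 + Gy \<bullet> q2))"
    using aug_lagrangian_gradient_gap[OF conv feas, where x = x and y = y and ls = ls]
    unfolding Gx_def Gy_def \<rho>_def by (intro diff_left_mono add_right_mono)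
  finally show ?thesis
    by (simp add: Gx_def Gy_def \<rho>_def algebra_simps)
qed

section \<open>Convergence rates\<close>

theorem theorem4p4:
  fixes f :: "real^'n1 \<Rightarrow> real" and g :: "real^'n2 \<Rightarrow> real"
    and gradf :: "real^'n1 \<Rightarrow> real^'n1" and gradg :: "real^'n2 \<Rightarrow> real^'n2"
    and A :: "real^'n1^'m" and B :: "real^'n2^'m" and b :: "real^'m"
    and t0 \<alpha> r r0 :: real
    and \<epsilon>1 :: "real \<Rightarrow> real^'n1" and \<epsilon>2 :: "real \<Rightarrow> real^'n2"
    and xs :: "real^'n1" and ys :: "real^'n2" and ls :: "real^'m"
    and x x' :: "real \<Rightarrow> real^'n1" and y y' :: "real \<Rightarrow> real^'n2" and l l' :: "real \<Rightarrow> real^'m"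
  assumes "smooth_convex f gradf" and "smooth_convex g gradg"
    and "t0 \<ge> 1" and "-1 < r" and "r \<le> 0" and "\<alpha> > 0" and "r0 > (r + 1) / 2"
    and "locally_integrable_from t0 \<epsilon>1" and "locally_integrable_from t0 \<epsilon>2"
    and "(\<lambda>t. t powr ((r + 1) / 2) * norm (\<epsilon>1 t)) absolutely_integrable_on {t0..}"
    and "(\<lambda>t. t powr ((r + 1) / 2) * norm (\<epsilon>2 t)) absolutely_integrable_on {t0..}"
    and "(xs, ys, ls) \<in> kkt_set gradf gradg A B b"
    and "global_solution gradf gradg A B b t0 (\<lambda>t. \<alpha> / t powr r) (\<lambda>t. t / (2 * r0))
           \<epsilon>1 \<epsilon>2 x y l x' y' l'"
  shows "((\<lambda>t. aug_lagrangian f g A B b (x t) (y t) ls - aug_lagrangian f g A B b xs ys ls)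
           \<in> O(\<lambda>t. t powr (- (r + 1)))) \<and>
    ((\<lambda>t. norm (A *v x t + B *v y t - b)) \<in> O(\<lambda>t. t powr (- ((r + 1) / 2)))) \<and>
    ((\<lambda>t. t powr r * (norm (A *v x t + B *v y t - b))\<^sup>2) absolutely_integrable_on {t0..}) \<and>
    ((\<lambda>t. t * ((norm (x' t))\<^sup>2 + (norm (y' t))\<^sup>2 + (norm (l' t))\<^sup>2))
           absolutely_integrable_on {t0..}) \<and>
    ((\<lambda>t. t powr r * (aug_lagrangian f g A B b (x t) (y t) ls
                          - aug_lagrangian f g A B b xs ys ls)) absolutely_integrable_on {t0..}) \<and>
    ((\<lambda>t. norm (x' t) + norm (y' t) + norm (l' t)) \<in> O(\<lambda>t. t powr (- ((r + 1) / 2))))"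
proof -
  have r: "-1 < r" "r \<le> 0" and t0: "t0 \<ge> 1" and \<alpha>: "\<alpha> > 0" and r0: "r0 > (r + 1) / 2"
    and conv: "smooth_convex f gradf" "smooth_convex g gradg"
    and kkt: "(xs, ys, ls) \<in> kkt_set gradf gradg A B b"
    using assms by auto
  note sol = assms(13)[unfolded global_solution_def]
  have C1: "C1_with_locally_ac_deriv t0 x x'" "C1_with_locally_ac_deriv t0 y y'" "C1_with_locally_ac_deriv t0 l l'"
    using sol by blast+
  define p where "p = (r + 1) / 2"
  define w w' where "w t = (x t, y t, l t)" and "w' t = (x' t, y' t, l' t)" for t
  define c where "c = (xs, ys, ls)"
  define \<rho> where "\<rho> t = A *v x t + B *v y t - b" for t
  define L where "L t = aug_lagrangian f g A B b (x t) (y t) ls - aug_lagrangian f g A B b xs ys ls" for t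
  define L' where "L' t = (gradf (x t) + transpose A *v (ls + \<rho> t)) \<bullet> x' t
    + (gradg (y t) + transpose B *v (ls + \<rho> t)) \<bullet> y' t" for t
  define N where "N t = norm (\<epsilon>1 t) + norm (\<epsilon>2 t)" for t
  have w_C1: "C1_with_locally_ac_deriv t0 w w'"
    unfolding w_def w'_def by (intro C1_with_locally_ac_deriv_Pair C1)
  have deriv: "(x has_vector_derivative x' t) (at t within {t0..})"
    "(y has_vector_derivative y' t) (at t within {t0..})" if "t \<ge> t0" for t
    using C1 that by (auto simp: C1_with_locally_ac_deriv_def)
  have cont: "continuous_on {t0..} x" "continuous_on {t0..} y"
    using deriv by (auto intro!: continuous_on_vector_derivative)
  have cont': "continuous_on {t0..} x'" "continuous_on {t0..} y'"
    using C1 by (auto simp: C1_with_locally_ac_deriv_def)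
  have cont_grad: "continuous_on {t0..} (\<lambda>t. gradf (x t))" "continuous_on {t0..} (\<lambda>t. gradg (y t))"
    using conv cont by (auto simp: smooth_convex_def intro: continuous_on_compose2)
  have cont_matrix: "continuous_on {t0..} (\<lambda>t. Q *v h t)" if "continuous_on {t0..} h"
    for Q :: "real^'j^'k" and h
    by (rule bounded_linear.continuous_on[OF matrix_vector_mul_bounded_linear that])
  have \<rho>_cont: "continuous_on {t0..} \<rho>"
    unfolding \<rho>_def by (intro continuous_intros cont_matrix cont)
  have L_deriv: "(L has_vector_derivative L' t) (at t within {t0..})" if "t \<ge> t0" for t
    using has_vector_derivative_diff[OF aug_lagrangian_has_vector_derivative[OF conv deriv[OF that]]
        has_vector_derivative_const]
    by (simp add: L_def[abs_def] L'_def \<rho>_def)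
  have L'_cont: "continuous_on {t0..} L'"
    unfolding L'_def by (intro continuous_intros cont_grad cont' cont_matrix \<rho>_cont)
  have L_ge: "L t \<ge> 1 / 2 * (norm (\<rho> t))\<^sup>2" for t
    unfolding L_def \<rho>_def by (rule aug_lagrangian_gap_at_kkt[OF conv kkt])
  have L_nonneg: "L t \<ge> 0" for t
    by (rule order_trans[OF _ L_ge]) simp
  have N_int: "(\<lambda>t. t powr ((r + 1) / 2) * N t) integrable_on {t0..}"
    using integrable_add[OF assms(10,11)[THEN set_lebesgue_integral_eq_integral(1)]]
    by (simp add: N_def distrib_left)
  define diss where "diss t \<longleftrightarrow> (\<exists>w''. (w' has_vector_derivative w'') (at t within {t0..}) \<and>
      (w t - c + (t / (2 * r0)) *\<^sub>R w' t) \<bullet> (w'' + (\<alpha> / t powr r) *\<^sub>R w' t)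
        \<le> - (t / (2 * r0)) * L' t - L t - (norm (\<rho> t))\<^sup>2 / 2
          + N t * norm (w t - c + (t / (2 * r0)) *\<^sub>R w' t))" for t
  have "AE t in lebesgue. t \<ge> t0 \<longrightarrow> diss t"
    using sol[THEN conjunct2, THEN conjunct2, THEN conjunct2]
  proof eventually_elim
    case (elim t)
    show ?case
    proof
      assume "t \<ge> t0"
      with elim obtain x'' y'' l'' where d: "(x' has_vector_derivative x'') (at t within {t0..})"
          "(y' has_vector_derivative y'') (at t within {t0..})"
          "(l' has_vector_derivative l'') (at t within {t0..})"
        and F: "x'' + (\<alpha> / t powr r) *\<^sub>R x' t =
            - gradf (x t) - transpose A *v (l t + (t / (2 * r0)) *\<^sub>R l' t)
            - transpose A *v (A *v x t + B *v y t - b) + \<epsilon>1 t"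
          "y'' + (\<alpha> / t powr r) *\<^sub>R y' t =
            - gradg (y t) - transpose B *v (l t + (t / (2 * r0)) *\<^sub>R l' t)
            - transpose B *v (A *v x t + B *v y t - b) + \<epsilon>2 t"
          "l'' + (\<alpha> / t powr r) *\<^sub>R l' t =
            A *v (x t + (t / (2 * r0)) *\<^sub>R x' t) + B *v (y t + (t / (2 * r0)) *\<^sub>R y' t) - b"
        by blast
      have "(w' has_vector_derivative (x'', y'', l'')) (at t within {t0..})"
        unfolding w'_def by (intro has_vector_derivative_Pair d)
      moreover have "(x'', y'', l'') + (\<alpha> / t powr r) *\<^sub>R w' t
          = (x'' + (\<alpha> / t powr r) *\<^sub>R x' t, y'' + (\<alpha> / t powr r) *\<^sub>R y' t, l'' + (\<alpha> / t powr r) *\<^sub>R l' t)"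
        by (simp add: w'_def)
      ultimately show "diss t"
        using primal_dual_dissipation[OF conv kkt F refl]
        unfolding diss_def L_def L'_def \<rho>_def N_def w_def w'_def c_def by auto
    qed
  qed
  then obtain Z where Z: "negligible Z" and "\<And>t. t \<ge> t0 \<Longrightarrow> t \<notin> Z \<Longrightarrow> diss t"
    unfolding eventually_ae_filter negligible_iff_null_sets by auto
  note dissipation = this(2)[unfolded diss_def]
  have \<rho>2_cont: "continuous_on {t0..} (\<lambda>t. (norm (\<rho> t))\<^sup>2)"
    by (intro continuous_intros \<rho>_cont)
  have N_nonneg: "N t \<ge> 0" for t by (simp add: N_def)
  note decay = lyapunov_decay[OF t0 r \<alpha> r0 w_C1 L_deriv L'_cont L_nonneg \<rho>2_cont zero_le_power2
      N_nonneg N_int Z dissipation]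
  obtain T M where TM: "\<And>t. t \<ge> T \<Longrightarrow> t powr (r + 1) * L t \<le> M"
    "\<And>t. t \<ge> T \<Longrightarrow> t powr p * norm (w' t) \<le> M"
    using decay(1) unfolding p_def by blast
  have "M \<ge> 0"
    using TM(2)[of T] by (meson mult_nonneg_nonneg norm_ge_zero order_trans powr_ge_zero order_refl)
  have ev: "eventually (\<lambda>t. t \<ge> max T t0) at_top" by (rule eventually_ge_at_top)
  have move_power: "h \<le> m * t powr (- q)" if "t powr q * h \<le> m" "t > 0" for t q h m :: real
    using that by (simp add: powr_minus field_simps)
  have L_le: "L t \<le> M * t powr (- (r + 1))" if "t \<ge> max T t0" for t
    using TM(1)[of t] that t0 by (intro move_power) auto
  have a: "L \<in> O(\<lambda>t. t powr (- (r + 1)))"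
    by (rule bigoI[of _ M], rule eventually_mono[OF ev]) (use L_le L_nonneg in simp)
  have res: "(\<lambda>t. norm (\<rho> t)) \<in> O(\<lambda>t. t powr (- p))"
  proof (rule bigoI[of _ "sqrt (2 * M)"], rule eventually_mono[OF ev])
    fix t assume t: "t \<ge> max T t0"
    \<comment> \<open>The gap controls half of the squared residual.\<close>
    have "(norm (\<rho> t))\<^sup>2 \<le> 2 * M * t powr (- (r + 1))"
      using L_le[OF t] L_ge[of t] by simp
    also have "\<dots> = (sqrt (2 * M) * t powr (- p))\<^sup>2"
      using \<open>M \<ge> 0\<close> by (simp add: power_mult_distrib power2_eq_square[of "_ powr _"] powr_add[symmetric] p_def)
    finally have "norm (\<rho> t) \<le> sqrt (2 * M) * t powr (- p)"
      by (rule power2_le_imp_le) (use \<open>M \<ge> 0\<close> in simp)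
    then show "norm (norm (\<rho> t)) \<le> sqrt (2 * M) * norm (t powr (- p))" by simp
  qed
  have vel: "(\<lambda>t. norm (x' t) + norm (y' t) + norm (l' t)) \<in> O(\<lambda>t. t powr (- p))"
  proof (rule bigoI[of _ "3 * M"], rule eventually_mono[OF ev])
    fix t assume t: "t \<ge> max T t0"
    have "norm (x' t) \<le> norm (w' t)" unfolding w'_def by (rule norm_fst_le)
    moreover have "norm (y' t) \<le> norm (w' t)"
      unfolding w'_def by (rule order_trans[OF norm_fst_le norm_snd_le])
    moreover have "norm (l' t) \<le> norm (w' t)"
      unfolding w'_def by (rule order_trans[OF norm_snd_le norm_snd_le])
    moreover have "norm (w' t) \<le> M * t powr (- p)"
      using TM(2)[of t] t t0 by (intro move_power) auto
    ultimately show "norm (norm (x' t) + norm (y' t) + norm (l' t)) \<le> 3 * M * norm (t powr (- p))"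
      by simp
  qed
  have "(norm (w' t))\<^sup>2 = (norm (x' t))\<^sup>2 + (norm (y' t))\<^sup>2 + (norm (l' t))\<^sup>2" for t
    by (simp add: w'_def norm_Pair)
  then show ?thesis
    using a res vel decay(2,3,4) by (simp add: L_def[abs_def] \<rho>_def p_def)
qed

end
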